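(* Let $X=\overline{\mathcal O(x)}$ be a transitive subshift, where $x$ is recurrent and aperiodic (not periodic). If $$\limsup_{n\to\infty}\frac{c_X(n)}{n}<3,$$ then $X$ is uniquely ergodic.
   Context: A subshift is a closed, $\sigma$-invariant subset $X\subset\mathcal A^{\mathbb Z}$, where $\mathcal A$ is a finite alphabet, $\mathcal A^{\mathbb Z}$ carries the product topology, and $\sigma(x)_k=x_{k+1}$ is the left shift. A word of length $n$ in $X$ is a block $x_k x_{k+1}\cdots x_{k+n-1}$ occurring in some $x\in X$; $c_X(n)$ is the number of words of length $n$ in $X$. The orbit of $x$ is $\mathcal O(x)=\{\sigma^n(x):n\in\mathbb Z\}$. A point $x$ is recurrent if every word in $x$ occurs at least twice (equivalently, infinitely often) in $x$; it is periodic if $\sigma^p(x)=x$ for some integer $p\neq 0$. $X$ is uniquely ergodic if it has exactly one $\sigma$-invariant Borel probability measure. *)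

theory Defs
  imports "HOL-Probability.Probability"
begin

text \<open>
  The alphabet is a set \<open>A\<close> of symbols of an arbitrary type (no topology on the type is
  assumed), with the discrete topology.  Its finiteness is a hypothesis of the theorem.
\<close>

definition full_shift :: "'a set \<Rightarrow> (int \<Rightarrow> 'a) topology" where
  "full_shift A = product_topology (\<lambda>_. discrete_topology A) UNIV"

lemma topspace_full_shift: "topspace (full_shift A) = {x. \<forall>k. x k \<in> A}"
  by (auto simp: full_shift_def PiE_def Pi_def)

definition shift :: "(int \<Rightarrow> 'a) \<Rightarrow> int \<Rightarrow> 'a" where
  "shift x = (\<lambda>k. x (k + 1))"

text \<open>
  Integer powers of the shift, given by an explicit formula because \<open>(^^)\<close> only takes natural
  exponents.  The facts below show that this is the group of iterates of \<open>shift\<close>.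
\<close>

definition shift_pow :: "int \<Rightarrow> (int \<Rightarrow> 'a) \<Rightarrow> int \<Rightarrow> 'a" where
  "shift_pow n x = (\<lambda>k. x (k + n))"

lemma shift_pow_0: "shift_pow 0 = id"
  by (auto simp: shift_pow_def)

lemma shift_pow_1: "shift_pow 1 = shift"
  by (auto simp: shift_pow_def shift_def)

lemma shift_pow_add: "shift_pow (m + n) = shift_pow m \<circ> shift_pow n"
  by (auto simp: shift_pow_def fun_eq_iff algebra_simps)

lemma shift_pow_of_nat: "shift_pow (int n) = shift ^^ n"
  by (induction n) (simp_all only: shift_pow_0 shift_pow_1 shift_pow_add of_nat_0 of_nat_Suc
      funpow.simps)

definition subshift :: "'a set \<Rightarrow> (int \<Rightarrow> 'a) set \<Rightarrow> bool" where
  "subshift A X \<longleftrightarrow> closedin (full_shift A) X \<and> shift ` X = X"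

definition orbit :: "(int \<Rightarrow> 'a) \<Rightarrow> (int \<Rightarrow> 'a) set" where
  "orbit x = range (\<lambda>n. shift_pow n x)"

definition word_at :: "(int \<Rightarrow> 'a) \<Rightarrow> int \<Rightarrow> nat \<Rightarrow> 'a list" where
  "word_at x k n = map (\<lambda>i. x (k + int i)) [0..<n]"

definition words :: "(int \<Rightarrow> 'a) set \<Rightarrow> nat \<Rightarrow> 'a list set" where
  "words X n = {word_at x k n | x k. x \<in> X}"

definition complexity :: "(int \<Rightarrow> 'a) set \<Rightarrow> nat \<Rightarrow> nat" where
  "complexity X n = card (words X n)"

text \<open>Two occurrences of a word are occurrences at different positions; they may overlap.\<close>

definition recurrent :: "(int \<Rightarrow> 'a) \<Rightarrow> bool" where
  "recurrent x \<longleftrightarrow> (\<forall>k n. \<exists>j. j \<noteq> k \<and> word_at x j n = word_at x k n)"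

definition periodic :: "(int \<Rightarrow> 'a) \<Rightarrow> bool" where
  "periodic x \<longleftrightarrow> (\<exists>p. p \<noteq> 0 \<and> shift_pow p x = x)"

definition borel_algebra :: "'b topology \<Rightarrow> 'b measure" where
  "borel_algebra T = sigma (topspace T) {U. openin T U}"

lemma space_borel_algebra: "space (borel_algebra T) = topspace T"
  by (simp add: borel_algebra_def space_measure_of_conv)

lemma sets_borel_algebra: "sets (borel_algebra T) = sigma_sets (topspace T) {U. openin T U}"
  unfolding borel_algebra_def
  by (rule sets_measure_of) (auto dest: openin_subset)

text \<open>
  \<open>M\<close> lives on \<open>X\<close> itself, with the Borel sets of the subspace topology as its measurable
  sets; the equality of measurable sets also forces \<open>space M = X\<close>.  As \<open>X\<close> and its measurable
  sets are fixed and a value of type \<open>measure\<close> is zero off its measurable sets, equality of such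
  \<open>M\<close> is equality of set functions on the Borel sets.
\<close>

definition invariant_prob :: "'a set \<Rightarrow> (int \<Rightarrow> 'a) set \<Rightarrow> (int \<Rightarrow> 'a) measure \<Rightarrow> bool" where
  "invariant_prob A X M \<longleftrightarrow>
     prob_space M \<and>
     sets M = sets (borel_algebra (subtopology (full_shift A) X)) \<and>
     (\<forall>B\<in>sets M. emeasure M (shift -` B \<inter> X) = emeasure M B)"

lemma space_invariant_prob:
  assumes "subshift A X" "invariant_prob A X M"
  shows "space M = X"
proof -
  have "space M = topspace (subtopology (full_shift A) X)"
    using assms(2) by (metis invariant_prob_def sets_eq_imp_space_eq space_borel_algebra)
  with assms(1) show ?thesis
    by (auto simp: subshift_def dest: closedin_subset)
qed

definition uniquely_ergodic :: "'a set \<Rightarrow> (int \<Rightarrow> 'a) set \<Rightarrow> bool" where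
  "uniquely_ergodic A X \<longleftrightarrow> (\<exists>!M. invariant_prob A X M)"

end

theory Submission
  imports Defs
begin

text \<open>
  Suppose there are two invariant measures.  Then some word has different frequencies under them, so
  there are reals \<open>\<alpha> < \<beta>\<close> such that every Rauzy graph of \<open>x\<close> contains a simple closed walk along
  which this word is at least \<open>\<beta>\<close>-frequent on average, and another along which it is at most
  \<open>\<alpha>\<close>-frequent.  If the order \<open>n\<close> of the graph is large, the first frequency is so close to the
  maximum, and the second one so close to the minimum, that the bound holds on all stretches of
  length at least \<open>n / K\<close>: the two closed walks have no word of that length in common.

  Each of the two closed walks can be left, since the graph is strongly connected, so there are two
  right special words of every large length.  As the complexity is below \<open>(3 - \<epsilon>) n\<close>, there are
  large \<open>n\<close> with no further right special word of length \<open>n\<close>.  For such an \<open>n\<close> the graph consists of two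
  disjoint cycles and one path in each direction between them, both of length about \<open>n\<close> or more.
  Let \<open>R\<close> and \<open>S\<close> be the lengths of the shortest words of \<open>x\<close> that run from entering to leaving the
  first and the second cycle, respectively, and say \<open>R \<le> S\<close>.  A shortest stay in the first cycle
  yields a third right special word of every length between \<open>R\<close> and about \<open>R + S\<close>, because all
  entries into this cycle are preceded by the same word of length about \<open>S\<close>; a shortest stay in the
  second cycle yields a fourth one of every length between \<open>S\<close> and about \<open>R + S\<close>.  Hence the complexity
  at \<open>N = R + S\<close> is at least about \<open>2 R + 3 (S - R) + 4 R = 3 N\<close>.  If \<open>S\<close> is much larger than \<open>R\<close>,
  the third right special word alone gives the contradiction, at length \<open>K R\<close>.
\<close>

section \<open>Factors of bi-infinite words and Rauzy graphs\<close>

lemma length_word_at [simp]: "length (word_at y k n) = n"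
  by (simp add: word_at_def)

lemma nth_word_at [simp]: "i < n \<Longrightarrow> word_at y k n ! i = y (k + int i)"
  by (simp add: word_at_def)

lemma word_at_eq_iff:
  "word_at y k n = word_at z l n \<longleftrightarrow> (\<forall>i<n. y (k + int i) = z (l + int i))"
  by (auto simp: list_eq_iff_nth_eq)

lemma word_at_eqD:
  assumes "word_at y k n = word_at z l n" "0 \<le> d" "d + int m \<le> int n"
  shows "word_at y (k + d) m = word_at z (l + d) m"
  unfolding word_at_eq_iff
proof (intro allI impI)
  fix i assume "i < m"
  then have "nat d + i < n" "k + d + int i = k + int (nat d + i)" "l + d + int i = l + int (nat d + i)"
    using assms(2,3) by auto
  then show "y (k + d + int i) = z (l + d + int i)"
    using assms(1) unfolding word_at_eq_iff by metis
qed

lemma word_at_Suc: "word_at y k (Suc n) = word_at y k n @ [y (k + int n)]"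
  by (simp add: word_at_def)

lemma butlast_word_at: "butlast (word_at y k (Suc n)) = word_at y k n"
  by (simp add: word_at_Suc)

lemma tl_word_at: "tl (word_at y k (Suc n)) = word_at y (k + 1) n"
  by (rule nth_equalityI) (auto simp: nth_tl algebra_simps)

text \<open>These are the vertices of the Rauzy graph of order \<open>n\<close>. The words of length
  \<open>Suc n\<close> are its edges, with source \<open>butlast\<close> and target
  \<open>tl\<close>, so a sequence \<open>c\<close> with
  \<open>factors c (Suc n) \<subseteq> factors x (Suc n)\<close> encodes a bi-infinite walk in the
  graph of \<open>x\<close>.\<close>

definition factors :: "(int \<Rightarrow> 'a) \<Rightarrow> nat \<Rightarrow> 'a list set" where
  "factors y n = range (\<lambda>k. word_at y k n)"

lemma word_at_in_factors [simp, intro]: "word_at y k n \<in> factors y n"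
  by (simp add: factors_def)

lemma factors_subset_mono:
  assumes "factors y n \<subseteq> factors z n" "m \<le> n"
  shows "factors y m \<subseteq> factors z m"
proof
  fix v assume "v \<in> factors y m"
  then obtain k where v: "v = word_at y k m" by (auto simp: factors_def)
  obtain l where "word_at y k n = word_at z l n"
    using assms(1) by (auto simp: factors_def)
  then have "word_at y (k + 0) m = word_at z (l + 0) m"
    by (rule word_at_eqD) (use assms(2) in auto)
  then show "v \<in> factors z m" by (auto simp: v)
qed

lemma factors_butlast: "butlast ` factors y (Suc n) = factors y n"
  by (simp add: factors_def image_image butlast_word_at)

lemma factors_tl: "tl ` factors y (Suc n) = factors y n"
proof -
  have "range (\<lambda>k. word_at y (k + 1) n) = range (\<lambda>k. word_at y k n)"
    by (auto simp: image_def) (metis diff_add_cancel)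
  then show ?thesis by (simp add: factors_def image_image tl_word_at)
qed

section \<open>Forks of a graph with at most two more edges than vertices\<close>

text \<open>Used with \<open>E\<close> the edges and \<open>f\<close> the source or the target map.
  If three edges could be dropped without shrinking the image, the image would have at most
  \<open>card E - 3\<close> elements.\<close>

lemma no_three_redundant:
  assumes "finite E" "card E \<le> card (f ` E) + 2" "B \<subseteq> E" "card B = 3" "f ` B \<subseteq> f ` (E - B)"
  shows False
proof -
  have "f ` E \<subseteq> f ` (E - B)" using assms(5) by blast
  then have "card (f ` E) \<le> card (E - B)"
    using assms(1) by (meson card_image_le card_mono finite_Diff finite_imageI order_trans)
  also have "\<dots> = card E - 3"
    using assms by (simp add: card_Diff_subset finite_subset)
  finally have "card (f ` E) \<le> card E - 3" .
  moreover have "3 \<le> card E" using assms by (metis card_mono)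
  ultimately show False using assms(2) by linarith
qed

text \<open>With a third multiple value, one preimage of each of the three could be dropped.\<close>

lemma fork_values:
  assumes "finite E" "card E \<le> card (f ` E) + 2"
    and a: "a \<in> E" "a' \<in> E" "a \<noteq> a'" "f a' = f a"
    and b: "b \<in> E" "b' \<in> E" "b \<noteq> b'" "f b' = f b" "f a \<noteq> f b"
    and e: "e \<in> E" "e' \<in> E" "e \<noteq> e'" "f e' = f e"
  shows "f e = f a \<or> f e = f b"
proof (rule ccontr)
  assume ne: "\<not> ?thesis"
  have d: "e' \<noteq> a'" "e' \<noteq> b'" "a' \<noteq> b'" "e \<noteq> a'" "e \<noteq> b'" "a \<noteq> e'" "a \<noteq> b'" "b \<noteq> e'" "b \<noteq> a'"
    using ne a b e by metis+
  have "e \<in> E - {e', a', b'}" "a \<in> E - {e', a', b'}" "b \<in> E - {e', a', b'}"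
    using a b e d by auto
  then have "{f e, f a, f b} \<subseteq> f ` (E - {e', a', b'})" by blast
  then show False
    using no_three_redundant[OF assms(1,2), of "{e', a', b'}"] a b e d by simp
qed

text \<open>A third element \<open>z\<close> of the fibre would make \<open>e\<close> and
  \<open>e'\<close> redundant, and \<open>b'\<close> is redundant because of
  \<open>b\<close>.\<close>

lemma fork_fibre:
  assumes "finite E" "card E \<le> card (f ` E) + 2"
    and b: "b \<in> E" "b' \<in> E" "b \<noteq> b'" "f b' = f b"
    and e: "e \<in> E" "e' \<in> E" "z \<in> E" "e \<noteq> e'" "f e' = f e" "f z = f e" "f b \<noteq> f e"
  shows "z = e \<or> z = e'"
proof (rule ccontr)
  assume ne: "\<not> ?thesis"
  have d: "e \<noteq> b'" "e' \<noteq> b'" "z \<noteq> b'" "b \<noteq> e" "b \<noteq> e'"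
    using ne b e by metis+
  have "z \<in> E - {e, e', b'}" "b \<in> E - {e, e', b'}"
    using ne b e d by auto
  then have "{f z, f b} \<subseteq> f ` (E - {e, e', b'})" by blast
  then show False
    using no_three_redundant[OF assms(1,2), of "{e, e', b'}"] b e d by simp
qed

text \<open>Only \<open>f a\<close> and \<open>f b\<close> have several preimages, namely
  \<open>{a, a'}\<close> and \<open>{b, b'}\<close>, and \<open>g\<close> tells the two members of
  each fibre apart. So an edge is fixed by one end and the information whether the other end stays
  in \<open>C\<close> or \<open>D\<close>.\<close>

lemma fork_determined:
  assumes fin: "finite E" and card: "card E \<le> card (f ` E) + 2" and CD: "C \<inter> D = {}"
    and a: "a \<in> E" "a' \<in> E" "f a' = f a" "f a \<in> C" "g a \<in> C" "g a' \<notin> C"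
    and b: "b \<in> E" "b' \<in> E" "f b' = f b" "f b \<in> D" "g b \<in> D" "g b' \<notin> D"
    and e: "e \<in> E" "e' \<in> E" "f e' = f e"
    and eC: "f e \<in> C \<Longrightarrow> g e \<in> C \<longleftrightarrow> g e' \<in> C"
    and eD: "f e \<in> D \<Longrightarrow> g e \<in> D \<longleftrightarrow> g e' \<in> D"
  shows "e = e'"
proof (rule ccontr)
  assume ne: "e \<noteq> e'"
  have ab: "a \<noteq> a'" "b \<noteq> b'" "f a \<noteq> f b" using a b CD by auto
  consider "f e = f a" | "f e = f b"
    using fork_values[OF fin card a(1,2) ab(1) a(3) b(1,2) ab(2) b(3) ab(3) e(1,2) ne e(3)] by blast
  then show False
  proof cases
    case 1
    then show False
      using fork_fibre[OF fin card b(1,2) ab(2) b(3) e(1,2) a(1) ne e(3)]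
        fork_fibre[OF fin card b(1,2) ab(2) b(3) e(1,2) a(2) ne e(3)] ab eC a by metis
  next
    case 2
    then show False
      using fork_fibre[OF fin card a(1,2) ab(1) a(3) e(1,2) b(1) ne e(3)]
        fork_fibre[OF fin card a(1,2) ab(1) a(3) e(1,2) b(2) ne e(3)] ab eD b by metis
  qed
qed

section \<open>Right special words and recurrence\<close>

definition right_special :: "(int \<Rightarrow> 'a) \<Rightarrow> nat \<Rightarrow> 'a list set" where
  "right_special y n =
     {v. \<exists>i j. word_at y i n = v \<and> word_at y j n = v \<and> y (i + int n) \<noteq> y (j + int n)}"

text \<open>Sorting the words of length \<open>Suc n\<close> by their prefix of length
  \<open>n\<close> gives a nonempty class for every word of length \<open>n\<close>, and one with at
  least two elements for a right special word.\<close>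

lemma card_factors_Suc:
  assumes fin: "finite (factors y (Suc n))" and D: "D \<subseteq> right_special y n"
  shows "card (factors y n) + card D \<le> card (factors y (Suc n))"
proof -
  let ?E = "factors y (Suc n)" and ?V = "factors y n"
  define F where "F v = {e \<in> ?E. butlast e = v}" for v
  have finV: "finite ?V" using fin factors_butlast[of y n] by (metis finite_imageI)
  have DV: "D \<subseteq> ?V" using D by (auto simp: right_special_def)
  have E: "?E = (\<Union>v\<in>?V. F v)"
    unfolding F_def using factors_butlast[of y n] by auto
  have finF: "finite (F v)" for v using fin by (simp add: F_def)
  have 1: "1 \<le> card (F v)" if "v \<in> ?V" for v
  proof -
    have "v \<in> butlast ` factors y (Suc n)" using that by (simp add: factors_butlast)
    then have "F v \<noteq> {}" by (auto simp: F_def)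
    then show ?thesis using finF by (simp add: Suc_le_eq card_gt_0_iff)
  qed
  have 2: "2 \<le> card (F v)" if "v \<in> D" for v
  proof -
    obtain i j where ij: "word_at y i n = v" "word_at y j n = v" "y (i + int n) \<noteq> y (j + int n)"
      using D \<open>v \<in> D\<close> by (auto simp: right_special_def)
    then have "{word_at y i (Suc n), word_at y j (Suc n)} \<subseteq> F v"
      by (auto simp: F_def butlast_word_at)
    moreover have "card {word_at y i (Suc n), word_at y j (Suc n)} = 2"
      using ij by (simp add: word_at_Suc)
    ultimately show ?thesis using card_mono[OF finF] by metis
  qed
  have "card ?V + card D = (\<Sum>v\<in>?V. 1 + (if v \<in> D then 1 else 0))"
    unfolding sum.distrib using finV DV by (simp add: sum.If_cases Int_absorb1)
  also have "\<dots> \<le> (\<Sum>v\<in>?V. card (F v))"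
    by (rule sum_mono) (use 1 2 in \<open>simp add: numeral_2_eq_2\<close>)
  also have "\<dots> = card ?E"
    unfolding E by (rule card_UN_disjoint[symmetric]) (use finV finF in \<open>auto simp: F_def\<close>)
  finally show ?thesis .
qed

text \<open>If a word had a first occurrence \<open>a\<close> and a last occurrence
  \<open>b\<close>, the block spanning both would occur again at some \<open>j \<noteq> a\<close>,
  and \<open>j\<close> or \<open>j + (b - a)\<close> would lie outside
  \<open>{a..b}\<close>.\<close>

lemma infinite_occurrences:
  assumes "recurrent x"
  shows "infinite {j. word_at x j n = word_at x k n}"
proof
  let ?O = "{j. word_at x j n = word_at x k n}"
  assume fin: "finite ?O"
  have ne: "?O \<noteq> {}" by auto
  define a b where "a = Min ?O" and "b = Max ?O"
  have a: "a \<in> ?O" and b: "b \<in> ?O" using Min_in[OF fin ne] Max_in[OF fin ne] by (auto simp: a_def b_def)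
  have ab: "a \<le> b" using fin a by (simp add: b_def)
  define N where "N = nat (b - a) + n"
  obtain j where j: "j \<noteq> a" "word_at x j N = word_at x a N"
    using assms unfolding recurrent_def by blast
  have "word_at x (j + 0) n = word_at x (a + 0) n" 
    by (rule word_at_eqD[OF j(2)]) (auto simp: N_def)
  then have "j \<in> ?O" using a by simp
  then have "a \<le> j" using fin by (simp add: a_def)
  have "word_at x (j + (b - a)) n = word_at x (a + (b - a)) n" 
    by (rule word_at_eqD[OF j(2)]) (use ab in \<open>auto simp: N_def\<close>)
  then have "j + (b - a) \<in> ?O" using b by simp
  then have "j + (b - a) \<le> b" using fin by (simp add: b_def)
  then show False using \<open>a \<le> j\<close> j(1) by simp
qed

lemma infinite_int_spread:
  fixes S :: "int set"
  assumes "infinite S"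
  shows "\<exists>i\<in>S. \<exists>j\<in>S. i + D < j"
proof (rule ccontr)
  assume *: "\<not> ?thesis"
  obtain s where s: "s \<in> S" using assms by (metis finite.emptyI ex_in_conv)
  have "S \<subseteq> {s - D..s + D}"
  proof
    fix t assume "t \<in> S"
    then have "\<not> s + D < t" "\<not> t + D < s" using * s by blast+
    then show "t \<in> {s - D..s + D}" by auto
  qed
  then show False using assms finite_subset by blast
qed

text \<open>Strong connectivity of the Rauzy graph, with an arbitrary minimal gap. Both words lie in
  one block of \<open>x\<close>. This block has two occurrences far apart; the first word is taken
  from the left one and the second word from the right one.\<close>

lemma recurrent_connect:
  assumes "recurrent x"
  shows "\<exists>i j. i + D < j \<and> word_at x i n = word_at x k n \<and> word_at x j m = word_at x l m"
proof -
  define a where "a = min k l"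
  define N where "N = nat (max k l - a) + n + m"
  obtain p q where pq: "p + (\<bar>D\<bar> + \<bar>k - l\<bar>) < q" "word_at x p N = word_at x a N" "word_at x q N = word_at x a N"
    using infinite_int_spread[OF infinite_occurrences[OF assms, of N a]] by blast
  have "word_at x (p + (k - a)) n = word_at x (a + (k - a)) n"
    by (rule word_at_eqD[OF pq(2)]) (auto simp: N_def a_def)
  moreover have "word_at x (q + (l - a)) m = word_at x (a + (l - a)) m"
    by (rule word_at_eqD[OF pq(3)]) (auto simp: N_def a_def)
  moreover have "p + (k - a) + D < q + (l - a)" using pq(1) by linarith
  ultimately show ?thesis by (metis add.commute diff_add_cancel)
qed

lemma last_in_before:
  fixes i j :: int
  assumes "P i" "\<not> P j" "i < j"
  shows "\<exists>k. i \<le> k \<and> k < j \<and> P k \<and> \<not> P (k + 1)"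
proof (rule ccontr)
  assume *: "\<not> ?thesis"
  have "k \<le> j \<longrightarrow> P k" if "i \<le> k" for k
    using that
  proof (induction k rule: int_ge_induct)
    case base
    show ?case using assms(1) by simp
  next
    case (step k)
    then show ?case using * by (meson less_add_one less_le_trans less_imp_le)
  qed
  then have "P j" using assms(3) by simp
  then show False using assms(2) by simp
qed

text \<open>On its way from a vertex of \<open>c\<close> to \<open>d\<close>, the sequence
  \<open>x\<close> takes an edge that leaves the vertex set of \<open>c\<close>. The walk
  \<open>c\<close> also passes through the source of this edge and stays in its vertex set;
  \<open>i\<close> is an occurrence in \<open>x\<close> of the staying edge, \<open>j\<close> one of
  the leaving edge.\<close>

lemma recurrent_exit:
  assumes rec: "recurrent x" and c: "factors c (Suc n) \<subseteq> factors x (Suc n)"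
    and d: "d \<in> factors x n" "d \<notin> factors c n"
  shows "\<exists>i j. word_at x i n = word_at x j n \<and> word_at x i n \<in> factors c n \<and>
     word_at x (i + 1) n \<in> factors c n \<and> word_at x (j + 1) n \<notin> factors c n"
proof -
  have "word_at c 0 n \<in> factors x n"
    using factors_subset_mono[OF c, of n] by auto
  then obtain a where a: "word_at c 0 n = word_at x a n"
    by (auto simp: factors_def)
  obtain b where b: "d = word_at x b n" using d by (auto simp: factors_def)
  obtain i j where ij: "i + 0 < j" "word_at x i n = word_at x a n" "word_at x j n = word_at x b n"
    using recurrent_connect[OF rec] by blast
  then have "word_at x i n \<in> factors c n" "word_at x j n \<notin> factors c n" using d a b
    by (metis word_at_in_factors)+
  then obtain k where k: "word_at x k n \<in> factors c n" "word_at x (k + 1) n \<notin> factors c n"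
    using last_in_before[of "\<lambda>i. word_at x i n \<in> factors c n" i j] ij by auto
  obtain l where l: "word_at x k n = word_at c l n" using k by (auto simp: factors_def)
  obtain r where r: "word_at c l (Suc n) = word_at x r (Suc n)" using c unfolding factors_def by blast
  have "word_at c l n = word_at x r n" "word_at c (l + 1) n = word_at x (r + 1) n"
    using r by (metis butlast_word_at, metis tl_word_at)
  then show ?thesis using k l by (metis word_at_in_factors)
qed

lemma recurrent_entry:
  assumes rec: "recurrent x" and c: "factors c (Suc n) \<subseteq> factors x (Suc n)"
    and d: "d \<in> factors x n" "d \<notin> factors c n"
  shows "\<exists>i j. word_at x (i + 1) n = word_at x (j + 1) n \<and> word_at x (i + 1) n \<in> factors c n \<and>
     word_at x i n \<in> factors c n \<and> word_at x j n \<notin> factors c n"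
proof -
  have "word_at c 0 n \<in> factors x n"
    using factors_subset_mono[OF c, of n] by auto
  then obtain a where a: "word_at c 0 n = word_at x a n"
    by (auto simp: factors_def)
  obtain b where b: "d = word_at x b n" using d by (auto simp: factors_def)
  obtain i j where ij: "i + 0 < j" "word_at x i n = word_at x b n" "word_at x j n = word_at x a n"
    using recurrent_connect[OF rec] by blast
  then have "word_at x i n \<notin> factors c n" "word_at x j n \<in> factors c n" using d a b
    by (metis word_at_in_factors)+
  then obtain k where k: "word_at x k n \<notin> factors c n" "word_at x (k + 1) n \<in> factors c n"
    using last_in_before[of "\<lambda>i. word_at x i n \<notin> factors c n" i j] ij by auto
  obtain l where l: "word_at x (k + 1) n = word_at c l n" using k by (auto simp: factors_def)
  obtain r where r: "word_at c (l - 1) (Suc n) = word_at x r (Suc n)" using c unfolding factors_def by blast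
  have "word_at c (l - 1) n = word_at x r n" "word_at c (l - 1 + 1) n = word_at x (r + 1) n"
    using r by (metis butlast_word_at, metis tl_word_at)
  then show ?thesis using k l by (metis word_at_in_factors diff_add_cancel)
qed

lemma recurrent_right_special:
  assumes rec: "recurrent x" and c: "factors c (Suc n) \<subseteq> factors x (Suc n)"
    and d: "d \<in> factors x n" "d \<notin> factors c n"
  shows "factors c n \<inter> right_special x n \<noteq> {}"
proof -
  obtain i j where ij: "word_at x i n = word_at x j n" "word_at x i n \<in> factors c n"
     "word_at x (i + 1) n \<in> factors c n" "word_at x (j + 1) n \<notin> factors c n"
    using recurrent_exit[OF assms] by blast
  have "x (i + int n) \<noteq> x (j + int n)"
  proof
    assume "x (i + int n) = x (j + int n)"
    then have "word_at x i (Suc n) = word_at x j (Suc n)" using ij by (simp add: word_at_Suc)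
    then have "word_at x (i + 1) n = word_at x (j + 1) n" by (metis tl_word_at)
    then show False using ij by simp
  qed
  then show ?thesis using ij by (auto simp: right_special_def)
qed

section \<open>Rauzy graphs with two cycles\<close>

lemma word_at_extend_right:
  assumes "word_at y i N = word_at z j N" "y (i + int N) = z (j + int N)"
  shows "word_at y i (Suc N) = word_at z j (Suc N)"
  using assms by (simp add: word_at_Suc)

lemma word_at_extend_left:
  assumes "word_at y i N = word_at z j N" "y (i - 1) = z (j - 1)"
  shows "word_at y (i - 1) (Suc N) = word_at z (j - 1) (Suc N)"
  unfolding word_at_eq_iff
proof (intro allI impI)
  fix k assume k: "k < Suc N"
  show "y (i - 1 + int k) = z (j - 1 + int k)"
  proof (cases k)
    case (Suc l)
    then have "y (i + int l) = z (j + int l)" using assms(1) k unfolding word_at_eq_iff by simp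
    then show ?thesis using Suc by (simp add: algebra_simps)
  qed (use assms in simp)
qed

lemma word_at_last:
  assumes "word_at y i (Suc n) = word_at z j (Suc n)"
  shows "y (i + int n) = z (j + int n)"
  using assms by (simp add: word_at_Suc)

lemma word_at_first:
  assumes "word_at y i (Suc n) = word_at z j (Suc n)"
  shows "y i = z j"
  using assms[unfolded word_at_eq_iff, rule_format, of 0] by simp

text \<open>A maximal stay, bounded on both sides, is measured by its number of vertices:
  \<open>r\<close> vertices are spelled by a word of length \<open>n + r - 1\<close>.\<close>

definition run_length :: "(int \<Rightarrow> 'a) \<Rightarrow> nat \<Rightarrow> 'a list set \<Rightarrow> nat \<Rightarrow> bool" where
  "run_length y n W r \<longleftrightarrow> 0 < r \<and>
     (\<exists>i. word_at y (i - 1) n \<notin> W \<and> (\<forall>t<r. word_at y (i + int t) n \<in> W) \<and>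
          word_at y (i + int r) n \<notin> W)"

text \<open>By \<open>card_le\<close> there is no room for forks beyond those forced by leaving and
  entering the two vertex sets. Hence a vertex outside both has a unique successor and a unique
  predecessor.\<close>

locale two_cycles =
  fixes x c1 c2 :: "int \<Rightarrow> 'a" and n :: nat
  assumes rec: "recurrent x"
    and fin: "finite (factors x (Suc n))"
    and walk1: "factors c1 (Suc n) \<subseteq> factors x (Suc n)"
    and walk2: "factors c2 (Suc n) \<subseteq> factors x (Suc n)"
    and disj: "factors c1 n \<inter> factors c2 n = {}"
    and card_le: "card (factors x (Suc n)) \<le> card (factors x n) + 2"

lemma two_cycles_swap: "two_cycles x c1 c2 n \<Longrightarrow> two_cycles x c2 c1 n"
  unfolding two_cycles_def by blast

context two_cycles
begin

abbreviation "H \<equiv> factors c1 n"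
abbreviation "L \<equiv> factors c2 n"

lemma H_subset: "H \<subseteq> factors x n" and L_subset: "L \<subseteq> factors x n"
  using factors_subset_mono[OF walk1, of n] factors_subset_mono[OF walk2, of n] by auto

lemma H_ne: "word_at c1 0 n \<in> factors x n" "word_at c1 0 n \<notin> L"
  and L_ne: "word_at c2 0 n \<in> factors x n" "word_at c2 0 n \<notin> H"
  using H_subset L_subset disj by blast+

lemma L_occurs: obtains l where "word_at x l n \<in> L"
proof -
  obtain l where "word_at c2 0 n = word_at x l n" using L_ne(1) by (auto simp: factors_def)
  then show thesis using that[of l] by (metis word_at_in_factors)
qed

section \<open>The forced forks and the walks they determine\<close>

lemma exit_edges:
  obtains e e' where "e \<in> factors x (Suc n)" "e' \<in> factors x (Suc n)" "butlast e' = butlast e"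
    "butlast e \<in> H" "tl e \<in> H" "tl e' \<notin> H"
proof -
  obtain i j where ij: "word_at x i n = word_at x j n" "word_at x i n \<in> H"
     "word_at x (i + 1) n \<in> H" "word_at x (j + 1) n \<notin> H"
    using recurrent_exit[OF rec walk1 L_ne] by blast
  show thesis
    by (rule that[of "word_at x i (Suc n)" "word_at x j (Suc n)"])
      (use ij in \<open>simp_all add: butlast_word_at tl_word_at\<close>)
qed

lemma entry_edges:
  obtains e e' where "e \<in> factors x (Suc n)" "e' \<in> factors x (Suc n)" "tl e' = tl e"
    "tl e \<in> H" "butlast e \<in> H" "butlast e' \<notin> H"
proof -
  obtain i j where ij: "word_at x (i + 1) n = word_at x (j + 1) n" "word_at x (i + 1) n \<in> H"
     "word_at x i n \<in> H" "word_at x j n \<notin> H"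
    using recurrent_entry[OF rec walk1 L_ne] by blast
  show thesis
    by (rule that[of "word_at x i (Suc n)" "word_at x j (Suc n)"])
      (use ij in \<open>simp_all add: butlast_word_at tl_word_at\<close>)
qed

text \<open>By \<open>fork_determined\<close>, the only choice that a walk ever has is between
  staying in \<open>H\<close> and leaving it, and likewise for \<open>L\<close>.\<close>

lemma step_forward:
  assumes y: "factors y (Suc n) \<subseteq> factors x (Suc n)" and z: "factors z (Suc n) \<subseteq> factors x (Suc n)"
    and eq: "word_at y i n = word_at z j n"
    and "word_at z j n \<in> H \<Longrightarrow> word_at y (i + 1) n \<in> H \<longleftrightarrow> word_at z (j + 1) n \<in> H"
    and "word_at z j n \<in> L \<Longrightarrow> word_at y (i + 1) n \<in> L \<longleftrightarrow> word_at z (j + 1) n \<in> L"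
  shows "word_at y i (Suc n) = word_at z j (Suc n)"
proof -
  interpret sw: two_cycles x c2 c1 n by (rule two_cycles_swap) unfold_locales
  obtain a a' where a: "a \<in> factors x (Suc n)" "a' \<in> factors x (Suc n)" "butlast a' = butlast a"
    "butlast a \<in> H" "tl a \<in> H" "tl a' \<notin> H" by (rule exit_edges)
  obtain b b' where b: "b \<in> factors x (Suc n)" "b' \<in> factors x (Suc n)" "butlast b' = butlast b"
    "butlast b \<in> L" "tl b \<in> L" "tl b' \<notin> L" by (rule sw.exit_edges)
  have c: "card (factors x (Suc n)) \<le> card (butlast ` factors x (Suc n)) + 2"
    using card_le by (simp add: factors_butlast)
  show ?thesis
    by (rule fork_determined[OF fin c disj a b]) (use y z assms(3-5) in \<open>auto simp: butlast_word_at tl_word_at\<close>)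
qed

lemma step_backward:
  assumes y: "factors y (Suc n) \<subseteq> factors x (Suc n)" and z: "factors z (Suc n) \<subseteq> factors x (Suc n)"
    and eq: "word_at y i n = word_at z j n"
    and "word_at z j n \<in> H \<Longrightarrow> word_at y (i - 1) n \<in> H \<longleftrightarrow> word_at z (j - 1) n \<in> H"
    and "word_at z j n \<in> L \<Longrightarrow> word_at y (i - 1) n \<in> L \<longleftrightarrow> word_at z (j - 1) n \<in> L"
  shows "word_at y (i - 1) (Suc n) = word_at z (j - 1) (Suc n)"
proof -
  interpret sw: two_cycles x c2 c1 n by (rule two_cycles_swap) unfold_locales
  obtain a a' where a: "a \<in> factors x (Suc n)" "a' \<in> factors x (Suc n)" "tl a' = tl a"
    "tl a \<in> H" "butlast a \<in> H" "butlast a' \<notin> H" by (rule entry_edges)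
  obtain b b' where b: "b \<in> factors x (Suc n)" "b' \<in> factors x (Suc n)" "tl b' = tl b"
    "tl b \<in> L" "butlast b \<in> L" "butlast b' \<notin> L" by (rule sw.entry_edges)
  have c: "card (factors x (Suc n)) \<le> card (tl ` factors x (Suc n)) + 2"
    using card_le by (simp add: factors_tl)
  have tl: "tl (word_at u (k - 1) (Suc n)) = word_at u k n" for u :: "int \<Rightarrow> 'a" and k
    using tl_word_at[of u "k - 1" n] by simp
  show ?thesis
    by (rule fork_determined[OF fin c disj a b]) (use y z assms(3-5) in \<open>auto simp: butlast_word_at tl\<close>)
qed

text \<open>An entry vertex of \<open>H\<close> has two incoming edges, one from outside and one
  along \<open>c1\<close>. Only two vertices have several incoming edges, and one of these lies in
  \<open>L\<close>.\<close>

lemma entry_unique: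
  assumes "word_at x (i - 1) n \<notin> H" "word_at x i n \<in> H" "word_at x (j - 1) n \<notin> H" "word_at x j n \<in> H"
  shows "word_at x i n = word_at x j n"
proof -
  interpret sw: two_cycles x c2 c1 n by (rule two_cycles_swap) unfold_locales
  obtain b b' where b: "b \<in> factors x (Suc n)" "b' \<in> factors x (Suc n)" "tl b' = tl b"
    "tl b \<in> L" "butlast b \<in> L" "butlast b' \<notin> L" by (rule sw.entry_edges)
  have c: "card (factors x (Suc n)) \<le> card (tl ` factors x (Suc n)) + 2"
    using card_le by (simp add: factors_tl)
  have *: "\<exists>e \<in> factors x (Suc n). \<exists>e' \<in> factors x (Suc n). e \<noteq> e' \<and> tl e = word_at x i n \<and> tl e' = tl e"
    if "word_at x (i - 1) n \<notin> H" "word_at x i n \<in> H" for i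
  proof -
    obtain k where k: "word_at x i n = word_at c1 k n" using \<open>word_at x i n \<in> H\<close> by (auto simp: factors_def)
    have "word_at c1 (k - 1) (Suc n) \<in> factors x (Suc n)" using walk1 by auto
    moreover have "word_at x (i - 1) (Suc n) \<noteq> word_at c1 (k - 1) (Suc n)"
      using that by (metis butlast_word_at word_at_in_factors)
    moreover have "tl (word_at c1 (k - 1) (Suc n)) = word_at x i n" "tl (word_at x (i - 1) (Suc n)) = word_at x i n"
      using tl_word_at[of c1 "k - 1" n] tl_word_at[of x "i - 1" n] k by simp_all
    ultimately show ?thesis by (metis word_at_in_factors)
  qed
  obtain e e' where e: "e \<in> factors x (Suc n)" "e' \<in> factors x (Suc n)" "e \<noteq> e'" "tl e = word_at x i n" "tl e' = tl e"
    using *[OF assms(1,2)] by blast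
  obtain f f' where f: "f \<in> factors x (Suc n)" "f' \<in> factors x (Suc n)" "f \<noteq> f'" "tl f = word_at x j n" "tl f' = tl f"
    using *[OF assms(3,4)] by blast
  have "b \<noteq> b'" using b by auto
  moreover have "tl e \<noteq> tl b" "tl f \<noteq> tl b" using e(4) f(4) assms b disj by auto
  ultimately have "tl f = tl e"
    using fork_values[OF fin c e(1-3,5) b(1,2) _ b(3) _ f(1-3,5)] by blast
  then show ?thesis using e f by simp
qed

text \<open>Within \<open>H\<close>, the decision to stay fixes every step. With \<open>c1\<close>
  as second walk this shows that each stay in \<open>H\<close> spells a factor of
  \<open>c1\<close>.\<close>

lemma H_segment:
  assumes y: "factors y (Suc n) \<subseteq> factors x (Suc n)" and z: "factors z (Suc n) \<subseteq> factors x (Suc n)"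
    and "word_at y i n = word_at z j n" "\<And>t. t \<le> k \<Longrightarrow> word_at y (i + int t) n \<in> H"
      "\<And>t. t \<le> k \<Longrightarrow> word_at z (j + int t) n \<in> H"
  shows "word_at y i (n + k) = word_at z j (n + k)"
  using assms(4,5)
proof (induction k)
  case (Suc k)
  have IH: "word_at y i (n + k) = word_at z j (n + k)" using Suc by simp
  have "word_at y (i + int k) n = word_at z (j + int k) n"
    by (rule word_at_eqD[OF IH]) auto
  moreover have "word_at y (i + int k + 1) n \<in> H" "word_at z (j + int k + 1) n \<in> H"
    "word_at z (j + int k) n \<notin> L"
    using Suc.prems(1)[of "Suc k"] Suc.prems(2)[of "Suc k"] Suc.prems(2)[of k] disj
    by (auto simp: algebra_simps)
  ultimately have "word_at y (i + int k) (Suc n) = word_at z (j + int k) (Suc n)"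
    by (intro step_forward[OF y z]) simp_all
  from word_at_last[OF this] have "y (i + int (n + k)) = z (j + int (n + k))"
    by (simp add: algebra_simps)
  then show ?case using word_at_extend_right[OF IH] by simp
qed (use assms in simp)

lemma H_segment_cycle:
  assumes y: "factors y (Suc n) \<subseteq> factors x (Suc n)"
    and "\<And>t. t \<le> k \<Longrightarrow> word_at y (i + int t) n \<in> H"
  shows "word_at y i (n + k) \<in> factors c1 (n + k)"
proof -
  obtain j where "word_at y i n = word_at c1 j n" using assms(2)[of 0] by (auto simp: factors_def)
  then have "word_at y i (n + k) = word_at c1 j (n + k)"
    by (rule H_segment[OF y walk1]) (use assms in auto)
  then show ?thesis by simp
qed

lemma forward_follow:
  assumes y: "factors y (Suc n) \<subseteq> factors x (Suc n)" and z: "factors z (Suc n) \<subseteq> factors x (Suc n)"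
    and "word_at y i n = word_at z j n" "\<And>t. t < k \<Longrightarrow> word_at z (j + int t) n \<notin> H \<union> L"
  shows "word_at y i (n + k) = word_at z j (n + k)"
  using assms(4)
proof (induction k)
  case (Suc k)
  have IH: "word_at y i (n + k) = word_at z j (n + k)" using Suc by simp
  have "word_at y (i + int k) n = word_at z (j + int k) n"
    by (rule word_at_eqD[OF IH]) auto
  then have "word_at y (i + int k) (Suc n) = word_at z (j + int k) (Suc n)"
    by (rule step_forward[OF y z]) (use Suc.prems[of k] in auto)
  from word_at_last[OF this] have "y (i + int (n + k)) = z (j + int (n + k))"
    by (simp add: algebra_simps)
  then show ?case using word_at_extend_right[OF IH] by simp
qed (use assms in simp)

text \<open>Going back, two walks can part only at a vertex with several predecessors. Such vertices
  lie in \<open>H\<close> or \<open>L\<close>, where the hypotheses keep the walks together.\<close>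

lemma backward_follow:
  assumes y: "factors y (Suc n) \<subseteq> factors x (Suc n)" and z: "factors z (Suc n) \<subseteq> factors x (Suc n)"
    and "word_at y i n = word_at z j n"
    and "\<And>t. t < k \<Longrightarrow> word_at z (j - int t) n \<in> H \<Longrightarrow>
      word_at y (i - int t - 1) n \<in> H \<longleftrightarrow> word_at z (j - int t - 1) n \<in> H"
    and "\<And>t. t < k \<Longrightarrow> word_at z (j - int t) n \<in> L \<Longrightarrow>
      word_at y (i - int t - 1) n \<in> L \<longleftrightarrow> word_at z (j - int t - 1) n \<in> L"
  shows "word_at y (i - int k) (n + k) = word_at z (j - int k) (n + k)"
  using assms(4,5)
proof (induction k)
  case (Suc k)
  have IH: "word_at y (i - int k) (n + k) = word_at z (j - int k) (n + k)" using Suc by simp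
  have "word_at y (i - int k + 0) n = word_at z (j - int k + 0) n"
    by (rule word_at_eqD[OF IH]) auto
  then have "word_at y (i - int k) n = word_at z (j - int k) n" by simp
  then have "word_at y (i - int k - 1) (Suc n) = word_at z (j - int k - 1) (Suc n)"
    by (rule step_backward[OF y z]) (use Suc.prems[of k] in auto)
  then have "y (i - int k - 1) = z (j - int k - 1)"
    by (rule word_at_first)
  then show ?case using word_at_extend_left[OF IH] by (simp add: algebra_simps)
qed (use assms in simp)

section \<open>Passages between the two cycles\<close>

text \<open>\<open>d\<close> is the least distance from a visit of \<open>L\<close> to a later visit
  of \<open>H\<close>; a visit of either set in between would give a smaller one.\<close>

lemma transition:
  obtains j d where "0 < d" "word_at x j n \<in> L" "word_at x (j + int d) n \<in> H"
    "\<And>t. 0 < t \<Longrightarrow> t < d \<Longrightarrow> word_at x (j + int t) n \<notin> H \<union> L"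
proof -
  obtain a b where a: "word_at c2 0 n = word_at x a n" and b: "word_at c1 0 n = word_at x b n"
    using H_ne L_ne by (auto simp: factors_def)
  obtain p q where pq: "p + 0 < q" "word_at x p n = word_at x a n" "word_at x q n = word_at x b n"
    using recurrent_connect[OF rec] by blast
  define P where "P d \<longleftrightarrow> 0 < d \<and> (\<exists>j. word_at x j n \<in> L \<and> word_at x (j + int d) n \<in> H)" for d
  have "P (nat (q - p))"
    unfolding P_def using pq by (intro conjI exI[of _ p]) (auto simp flip: a b)
  define d where "d = (LEAST d. P d)"
  have "P d" unfolding d_def using \<open>P (nat (q - p))\<close> by (rule LeastI)
  have least: "\<not> P k" if "k < d" for k using not_less_Least that unfolding d_def by blast
  obtain j where j: "0 < d" "word_at x j n \<in> L" "word_at x (j + int d) n \<in> H" using \<open>P d\<close> by (auto simp: P_def)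
  show thesis
  proof (rule that[OF j])
    fix t assume t: "0 < t" "t < d"
    have "word_at x (j + int t) n \<notin> H" using least[of t] t j by (auto simp: P_def)
    moreover have "word_at x (j + int t) n \<notin> L"
      using least[of "d - t"] t j by (auto simp: P_def of_nat_diff algebra_simps)
    ultimately show "word_at x (j + int t) n \<notin> H \<union> L" by blast
  qed
qed

text \<open>All entries into \<open>H\<close> use the same vertex, and the passage leading to it
  from \<open>L\<close> has no fork on the way back once the last step is known to come from outside
  \<open>H\<close>.\<close>

lemma entry_backward:
  assumes d: "0 < d" "word_at x j n \<in> L" "word_at x (j + int d) n \<in> H"
    "\<And>t. 0 < t \<Longrightarrow> t < d \<Longrightarrow> word_at x (j + int t) n \<notin> H \<union> L"
    and i: "word_at x (i - 1) n \<notin> H" "word_at x i n \<in> H" and t: "t \<le> d"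
  shows "word_at x (i - int t) (n + t) = word_at x (j + int d - int t) (n + t)"
proof (rule backward_follow)
  have b: "word_at x (j + int d - int s) n \<notin> H \<union> L" if "0 < s" "s < d" for s
    using d(4)[of "d - s"] that by (auto simp: of_nat_diff algebra_simps)
  have d1: "word_at x (j + int d - 1) n \<notin> H"
    using b[of 1] d disj by (cases "d = 1") auto
  show "word_at x i n = word_at x (j + int d) n"
    by (rule entry_unique[OF i d1 d(3)])
  fix s assume s: "s < t"
  {
    assume "word_at x (j + int d - int s) n \<in> H"
    then have "s = 0" using b[of s] s t by auto
    then show "word_at x (i - int s - 1) n \<in> H \<longleftrightarrow> word_at x (j + int d - int s - 1) n \<in> H"
      using d1 i by simp
  }
  {
    assume "word_at x (j + int d - int s) n \<in> L"
    then have "s = 0" using b[of s] s t by auto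
    then show "word_at x (i - int s - 1) n \<in> L \<longleftrightarrow> word_at x (j + int d - int s - 1) n \<in> L"
      using \<open>word_at x (j + int d - int s) n \<in> L\<close> d disj by auto
  }
qed auto

lemma entry_from_L:
  assumes i: "word_at x (i - 1) n \<notin> H" "word_at x i n \<in> H"
  obtains d where "0 < d" "word_at x (i - int d) n \<in> L"
    "\<And>t. 0 < t \<Longrightarrow> t < d \<Longrightarrow> word_at x (i - int t) n \<notin> H \<union> L"
proof -
  obtain j d where d: "0 < d" "word_at x j n \<in> L" "word_at x (j + int d) n \<in> H"
    "\<And>t. 0 < t \<Longrightarrow> t < d \<Longrightarrow> word_at x (j + int t) n \<notin> H \<union> L" by (rule transition) blast
  have eq: "word_at x (i - int t) n = word_at x (j + int d - int t) n" if "t \<le> d" for t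
    using word_at_eqD[OF entry_backward[OF d i that], of 0 n] by simp
  show thesis
  proof (rule that[OF d(1)])
    show "word_at x (i - int d) n \<in> L" using eq[of d] d by simp
    fix t assume "0 < t" "t < d"
    then show "word_at x (i - int t) n \<notin> H \<union> L"
      using eq[of t] d(4)[of "d - t"] by (auto simp: of_nat_diff algebra_simps)
  qed
qed

text \<open>By recurrence \<open>x\<close> contains a visit of \<open>L\<close> followed by
  \<open>v\<close>, and this whole block is in turn followed by a visit of \<open>L\<close>.\<close>

lemma surrounded_by_L:
  assumes "v \<in> factors x n"
  obtains a k b where "a < k" "k < b" "word_at x a n \<in> L" "word_at x k n = v" "word_at x b n \<in> L"
proof -
  obtain l where l: "word_at x l n \<in> L" by (rule L_occurs)
  obtain m where m: "v = word_at x m n" using assms by (auto simp: factors_def)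
  obtain p q where pq: "p + 0 < q" "word_at x p n = word_at x l n" "word_at x q n = word_at x m n"
    using recurrent_connect[OF rec] by blast
  define N where "N = nat (q - p) + n"
  obtain a b where ab: "a + int N < b" "word_at x a N = word_at x p N" "word_at x b n = word_at x l n"
    using recurrent_connect[OF rec] by blast
  have "word_at x (a + 0) n = word_at x (p + 0) n"
    by (rule word_at_eqD[OF ab(2)]) (auto simp: N_def)
  moreover have "word_at x (a + (q - p)) n = word_at x (p + (q - p)) n"
    by (rule word_at_eqD[OF ab(2)]) (use pq in \<open>auto simp: N_def\<close>)
  ultimately show thesis
    using ab pq l m by (intro that[of a "a + (q - p)" b]) (auto simp: N_def)
qed

text \<open>Suppose that \<open>y\<close> avoids \<open>L\<close>. From an occurrence in
  \<open>x\<close> of a vertex of \<open>y\<close> outside \<open>H\<close>, the nearest visits of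
  \<open>H \<union> L\<close> on both sides are shared with \<open>y\<close>, as there are no forks
  in between; so both are in \<open>H\<close>. Then \<open>x\<close> returns to \<open>H\<close>
  without having been in \<open>L\<close>, against \<open>entry_from_L\<close>.\<close>

lemma visits_L:
  assumes y: "factors y (Suc n) \<subseteq> factors x (Suc n)" and i: "word_at y i n \<notin> H"
  shows "\<exists>j. word_at y j n \<in> L"
proof (rule ccontr)
  assume no: "\<not> ?thesis"
  have "word_at y i n \<in> factors x n"
    using factors_subset_mono[OF y, of n] by auto
  then obtain a k b where akb: "a < k" "k < b" "word_at x a n \<in> L" "word_at x k n = word_at y i n" "word_at x b n \<in> L"
    by (rule surrounded_by_L)
  define S where "S = H \<union> L"
  have kS: "word_at x k n \<notin> S" using no i akb by (metis S_def UnE)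
  define f where "f = (LEAST f. word_at x (k + int f) n \<in> S)"
  define g where "g = (LEAST g. word_at x (k - int g) n \<in> S)"
  have f: "word_at x (k + int f) n \<in> S" unfolding f_def
    by (rule LeastI[of _ "nat (b - k)"]) (use akb in \<open>simp add: S_def\<close>)
  have g: "word_at x (k - int g) n \<in> S" unfolding g_def
    by (rule LeastI[of _ "nat (k - a)"]) (use akb in \<open>simp add: S_def\<close>)
  have lf: "word_at x (k + int t) n \<notin> S" if "t < f" for t using not_less_Least that unfolding f_def by blast
  have lg: "word_at x (k - int t) n \<notin> S" if "t < g" for t using not_less_Least that unfolding g_def by blast
  have fg0: "0 < f" "0 < g" using f g kS by (auto intro: Nat.gr0I)
  have "word_at y i (n + f) = word_at x k (n + f)"
    by (rule forward_follow[OF y]) (use akb lf in \<open>auto simp: S_def\<close>)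
  then have "word_at y (i + int f) n = word_at x (k + int f) n"
    by (rule word_at_eqD) auto
  then have fH: "word_at x (k + int f) n \<in> H" using no f by (metis S_def UnE)
  have "word_at y (i - int g) (n + g) = word_at x (k - int g) (n + g)"
    by (rule backward_follow[OF y]) (use akb lg in \<open>auto simp: S_def\<close>)
  then have "word_at y (i - int g + 0) n = word_at x (k - int g + 0) n"
    by (rule word_at_eqD) auto
  then have gH: "word_at x (k - int g) n \<in> H" using no g by (metis S_def UnE add.right_neutral)
  have between: "word_at x p n \<notin> S" if "k - int g < p" "p < k + int f" for p
    using lf[of "nat (p - k)"] lg[of "nat (k - p)"] that by (cases "k \<le> p") auto
  have ent: "word_at x (k + int f - 1) n \<notin> H" using between[of "k + int f - 1"] fg0 by (auto simp: S_def)
  obtain d where d: "0 < d" "word_at x (k + int f - int d) n \<in> L"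
    "\<And>t. 0 < t \<Longrightarrow> t < d \<Longrightarrow> word_at x (k + int f - int t) n \<notin> H \<union> L"
    by (rule entry_from_L[OF ent fH]) blast
  show False
  proof (cases "d < f + g")
    case True
    then show False using between[of "k + int f - int d"] d by (auto simp: S_def)
  next
    case False
    then show False
      using d(2) d(3)[of "f + g"] gH disj fg0 by (cases "d = f + g") auto
  qed
qed

lemma finite_run:
  obtains r where "run_length x n H r"
proof -
  obtain a k b where akb: "a < k" "k < b" "word_at x a n \<in> L" "word_at x k n = word_at c1 0 n" "word_at x b n \<in> L"
    using surrounded_by_L[OF H_ne(1)] by blast
  have H: "word_at x a n \<notin> H" "word_at x k n \<in> H" "word_at x b n \<notin> H" using akb disj by auto
  obtain p where p: "p < k" "word_at x p n \<notin> H" "word_at x (p + 1) n \<in> H"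
    using last_in_before[of "\<lambda>i. word_at x i n \<notin> H" a k] H akb by auto
  define r where "r = (LEAST r. word_at x (p + 1 + int r) n \<notin> H)"
  have r: "word_at x (p + 1 + int r) n \<notin> H" unfolding r_def
    by (rule LeastI[of _ "nat (b - p - 1)"]) (use H p akb in simp)
  have "word_at x (p + 1 + int t) n \<in> H" if "t < r" for t using not_less_Least that unfolding r_def by blast
  moreover have "0 < r" using r p by (auto intro: Nat.gr0I)
  ultimately have "run_length x n H r"
    unfolding run_length_def using p r by (intro conjI exI[of _ "p + 1"]) auto
  then show thesis by (rule that)
qed

section \<open>Stays in a cycle and the right special words they produce\<close>

text \<open>Otherwise \<open>y\<close> visits \<open>L\<close>. If it spends
  \<open>min b (m - n)\<close> consecutive vertices there, it reads a factor of \<open>c2\<close>,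
  which \<open>sep\<close> forbids. If it never does, some shorter stay and its two neighbours fit
  into a word of length \<open>m\<close>; this word occurs in \<open>x\<close>, which then has a run
  in \<open>L\<close> of length below \<open>b\<close>.\<close>

lemma stays_in_H:
  assumes m: "n < m" "factors y m \<subseteq> factors x m"
    and b: "0 < b" "\<And>r. run_length x n L r \<Longrightarrow> b \<le> r"
    and sep: "factors y (n + min b (m - n) - 1) \<inter> factors c2 (n + min b (m - n) - 1) = {}"
  shows "factors y n \<subseteq> H"
proof (rule ccontr)
  interpret sw: two_cycles x c2 c1 n by (rule two_cycles_swap) unfold_locales
  assume nsub: "\<not> ?thesis"
  have y: "factors y (Suc n) \<subseteq> factors x (Suc n)"
    by (rule factors_subset_mono[OF m(2)]) (use m(1) in simp)
  obtain j where j: "word_at y j n \<in> L"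
    using visits_L[OF y] nsub unfolding factors_def by blast
  define q where "q = min b (m - n)"
  have q: "0 < q" using b m by (simp add: q_def)
  have "\<exists>i. \<forall>t<q. word_at y (i + int t) n \<in> L"
  proof (rule ccontr)
    assume no: "\<not> ?thesis"
    then obtain t where "\<not> word_at y (j + int t) n \<in> L" by blast
    then have "t \<noteq> 0" using j by (intro notI) simp
    then obtain e where e: "word_at y e n \<in> L" "word_at y (e + 1) n \<notin> L"
      using last_in_before[of "\<lambda>i. word_at y i n \<in> L" j "j + int t"] j \<open>\<not> word_at y (j + int t) n \<in> L\<close> by auto
    have "\<exists>s<q. word_at y (e - int s) n \<notin> L"
    proof (rule ccontr)
      assume *: "\<not> ?thesis"
      have "\<forall>t<q. word_at y (e - int (q - 1) + int t) n \<in> L"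
      proof (intro allI impI)
        fix t assume "t < q"
        then have "e - int (q - 1) + int t = e - int (q - 1 - t)" by simp
        moreover have "q - 1 - t < q" using q by simp
        ultimately show "word_at y (e - int (q - 1) + int t) n \<in> L"
          using * by metis
      qed
      then show False using no by blast
    qed
    then obtain s0 where s0: "s0 < q" "word_at y (e - int s0) n \<notin> L" by blast
    define s where "s = (LEAST s. word_at y (e - int s) n \<notin> L)"
    have s: "word_at y (e - int s) n \<notin> L" unfolding s_def by (rule LeastI[of _ s0]) (rule s0)
    have sl: "word_at y (e - int t) n \<in> L" if "t < s" for t using not_less_Least that unfolding s_def by blast
    have "s \<le> s0" unfolding s_def by (rule Least_le) (rule s0)
    have "0 < s" using s e by (auto intro: Nat.gr0I)
    obtain k where k: "word_at y (e - int s) m = word_at x k m" using m(2) unfolding factors_def by blast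
    \<comment> \<open>The stay with the vertices before and after it has \<open>s + 2\<close>
      vertices, hence \<open>n + s + 1\<close> letters.\<close>
    have sm: "int s + 1 + int n \<le> int m" using \<open>s \<le> s0\<close> s0 unfolding q_def by linarith
    have eq: "word_at y (e - int s + t) n = word_at x (k + t) n" if "0 \<le> t" "t \<le> int s + 1" for t
      by (rule word_at_eqD[OF k]) (use that sm in auto)
    have "run_length x n L s"
      unfolding run_length_def
    proof (intro conjI exI[of _ "k + 1"] allI impI)
      show "word_at x (k + 1 - 1) n \<notin> L" using eq[of 0] s by simp
      show "word_at x (k + 1 + int s) n \<notin> L" using eq[of "int s + 1"] e by (simp add: algebra_simps)
      fix t assume "t < s"
      then have "e - int s + (int t + 1) = e - int (s - t - 1)" by auto
      moreover have "word_at y (e - int (s - t - 1)) n \<in> L" by (rule sl) (use \<open>t < s\<close> in simp)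
      ultimately have "word_at y (e - int s + (int t + 1)) n \<in> L" by (simp only:)
      then show "word_at x (k + 1 + int t) n \<in> L" using eq[of "int t + 1"] \<open>t < s\<close> by (simp add: algebra_simps)
    qed fact
    then have "b \<le> s" by (rule b)
    then show False using \<open>s \<le> s0\<close> s0 by (simp add: q_def)
  qed
  then obtain i where i: "\<And>t. t < q \<Longrightarrow> word_at y (i + int t) n \<in> L" by blast
  have "word_at y i (n + (q - 1)) \<in> factors c2 (n + (q - 1))"
    by (rule sw.H_segment_cycle[OF y]) (use i q in auto)
  then show False using sep q unfolding q_def[symmetric]
    by (metis Nat.add_diff_assoc One_nat_def Suc_leI disjoint_iff word_at_in_factors)
qed

text \<open>As \<open>y\<close> never leaves \<open>H\<close>, somewhere \<open>x\<close> stays in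
  \<open>H\<close> for \<open>a + 1\<close> vertices. Moving back to the entry only lengthens the
  stay; an earlier visit of \<open>L\<close> guarantees that there is an entry.\<close>

lemma longer_run:
  assumes y: "factors y n \<subseteq> H" and m: "factors y m \<subseteq> factors x m" "n + a \<le> m"
  shows "\<exists>i. word_at x (i - 1) n \<notin> H \<and> (\<forall>t\<le>a. word_at x (i + int t) n \<in> H)"
proof -
  obtain k where k: "word_at y 0 m = word_at x k m" using m unfolding factors_def by blast
  obtain l where l: "word_at x l n \<in> L" by (rule L_occurs)
  obtain p q where pq: "p + 0 < q" "word_at x p n = word_at x l n" "word_at x q m = word_at x k m"
    using recurrent_connect[OF rec] by blast
  have q: "word_at x (q + t) n \<in> H" if "0 \<le> t" "t \<le> int a" for t
  proof -
    have "word_at x (q + t) n = word_at y (0 + t) n"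
      by (rule word_at_eqD[where n = m]) (use pq k that m in auto)
    then show ?thesis using y by auto
  qed
  define s where "s = (LEAST s. word_at x (q - 1 - int s) n \<notin> H)"
  have s: "word_at x (q - 1 - int s) n \<notin> H" unfolding s_def
    by (rule LeastI[of _ "nat (q - 1 - p)"]) (use pq l disj in auto)
  have sl: "word_at x (q - 1 - int t) n \<in> H" if "t < s" for t using not_less_Least that unfolding s_def by blast
  have "word_at x (q - int s + int t) n \<in> H" if "t \<le> a" for t
  proof (cases "t < s")
    case True
    then have "q - int s + int t = q - 1 - int (s - t - 1)" by auto
    then show ?thesis using sl[of "s - t - 1"] True by (simp only:)
  next
    case False
    then have "q - int s + int t = q + int (t - s)" by auto
    then show ?thesis using q[of "int (t - s)"] that by (simp only:)
  qed
  then show ?thesis using s by (intro exI[of _ "q - int s"]) (auto simp: algebra_simps)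
qed

text \<open>The run at \<open>p\<close> ends after \<open>a\<close> vertices, the stay from
  \<open>q\<close> lasts longer. Both begin at the unique entry vertex, so the same
  \<open>n + a - 1\<close> letters are read from \<open>p\<close> and \<open>q\<close>, and then
  different ones. To the left the two positions agree along the passage of \<open>d\<close> letters
  from \<open>L\<close> and for \<open>b - 1\<close> letters more. Each extension by
  \<open>t\<close> of these letters is right special.\<close>

lemma extra_right_special:
  assumes a: "run_length x n H a" and long: "word_at x (q - 1) n \<notin> H" "\<And>t. t \<le> a \<Longrightarrow> word_at x (q + int t) n \<in> H"
    and b: "0 < b" "\<And>r. run_length x n L r \<Longrightarrow> b \<le> r"
  obtains d where "factors c1 (n - d) \<inter> factors c2 (n - d) \<noteq> {}"
    "\<And>t. 0 < t \<Longrightarrow> t < d + b \<Longrightarrow> \<exists>i. word_at x i (n + a - 1 + t) \<in> right_special x (n + a - 1 + t) \<and>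
       word_at x (i + int t - 1) n \<notin> H \<and> word_at x (i + int t + int a - 1) n \<in> H"
proof -
  interpret sw: two_cycles x c2 c1 n by (rule two_cycles_swap) unfold_locales
  obtain j d where d: "0 < d" "word_at x j n \<in> L" "word_at x (j + int d) n \<in> H"
    "\<And>t. 0 < t \<Longrightarrow> t < d \<Longrightarrow> word_at x (j + int t) n \<notin> H \<union> L" by (rule transition) blast
  obtain p where p: "0 < a" "word_at x (p - 1) n \<notin> H" "\<And>t. t < a \<Longrightarrow> word_at x (p + int t) n \<in> H"
    "word_at x (p + int a) n \<notin> H"
    using a unfolding run_length_def by blast
  have pH: "word_at x p n \<in> H" and qH: "word_at x q n \<in> H"
    using p(3)[of 0] p(1) long(2)[of 0] by auto
  have walk: "factors x (Suc n) \<subseteq> factors x (Suc n)" by simp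
  have "word_at x p (n + (a - 1)) = word_at x q (n + (a - 1))"
    by (rule H_segment[OF walk walk entry_unique]) (use p long pH qH in auto)
  then have fw: "word_at x p (n + a - 1) = word_at x q (n + a - 1)" using p(1) by simp
  have ne: "x (p + int (n + a - 1)) \<noteq> x (q + int (n + a - 1))"
  proof
    assume "x (p + int (n + a - 1)) = x (q + int (n + a - 1))"
    then have "word_at x p (Suc (n + a - 1)) = word_at x q (Suc (n + a - 1))"
      using fw by (rule word_at_extend_right[rotated])
    then have "word_at x (p + int a) n = word_at x (q + int a) n"
      by (rule word_at_eqD) (use p(1) in auto)
    then show False using p(4) long(2)[of a] by simp
  qed
  text \<open>An entry into \<open>H\<close> is preceded by the fixed path from \<open>L\<close> and at least \<open>b\<close> vertices of \<open>L\<close>.\<close>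
  have bk: "word_at x (e - int t) n = word_at x (j + int d - int t) n"
    if "t \<le> d" "word_at x (e - 1) n \<notin> H" "word_at x e n \<in> H" for e t
    using word_at_eqD[OF entry_backward[OF d that(2,3,1)], of 0 n] by simp
  have inL: "word_at x (e - int d - int s) n \<in> L"
    if e: "s < b" "word_at x (e - 1) n \<notin> H" "word_at x e n \<in> H" for e s
  proof (rule ccontr)
    assume no: "\<not> ?thesis"
    define u where "u = (LEAST u. word_at x (e - int d - int u) n \<notin> L)"
    have u: "word_at x (e - int d - int u) n \<notin> L" unfolding u_def by (rule LeastI) (rule no)
    have ul: "word_at x (e - int d - int t) n \<in> L" if "t < u" for t using not_less_Least that unfolding u_def by blast
    have "u \<le> s" unfolding u_def by (rule Least_le) (rule no)
    have e0: "word_at x (e - int d) n \<in> L" using bk[of d e] e d by simp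
    have e1: "word_at x (e - int d + 1) n \<notin> L"
    proof (cases "d = 1")
      case False
      then have "word_at x (e - int (d - 1)) n \<notin> L" using bk[of "d - 1" e] e d(4)[of 1] d(1) by auto
      then show ?thesis using d(1) by (simp add: of_nat_diff algebra_simps)
    qed (use e disj in auto)
    have "0 < u" using u e0 by (auto intro: Nat.gr0I)
    have "run_length x n L u"
      unfolding run_length_def
    proof (intro conjI exI[of _ "e - int d - int u + 1"] allI impI)
      fix t assume "t < u"
      then show "word_at x (e - int d - int u + 1 + int t) n \<in> L"
        using ul[of "u - t - 1"] by (auto simp: of_nat_diff algebra_simps)
    next
      have "e - int d - int u + 1 + int u = e - int d + 1" by simp
      then show "word_at x (e - int d - int u + 1 + int u) n \<notin> L" using e1 by (simp only:) simp
    qed (use u \<open>0 < u\<close> in auto)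
    then show False using b(2) \<open>u \<le> s\<close> e(1) by fastforce
  qed
  \<comment> \<open>For \<open>d\<close> steps back both positions follow the same passage; after
    that both are in \<open>L\<close>, where staying leaves no choice.\<close>
  have bw: "word_at x (p - int t) (n + t) = word_at x (q - int t) (n + t)" if t: "t < d + b" for t
  proof (rule backward_follow[OF walk walk])
    show "word_at x p n = word_at x q n" by (rule entry_unique) (use p long pH qH in auto)
    fix s assume s: "s < t"
    have "word_at x (p - int s - 1) n \<in> L \<and> word_at x (q - int s - 1) n \<in> L" if "d \<le> s"
    proof -
      have "p - int s - 1 = p - int d - int (s + 1 - d)" "q - int s - 1 = q - int d - int (s + 1 - d)" 
        using that by auto
      moreover have "s + 1 - d < b" using s t that by simp
      ultimately show ?thesis using inL p(2) pH long(1) qH by metis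
    qed
    moreover have "word_at x (p - int s - 1) n = word_at x (q - int s - 1) n" if "s < d"
      using bk[of "Suc s" p] bk[of "Suc s" q] that p(2) pH long(1) qH by (simp add: algebra_simps)
    ultimately show "word_at x (p - int s - 1) n \<in> H \<longleftrightarrow> word_at x (q - int s - 1) n \<in> H"
      "word_at x (p - int s - 1) n \<in> L \<longleftrightarrow> word_at x (q - int s - 1) n \<in> L"
      using disj by (cases "s < d"; fastforce)+
  qed
  show thesis
  proof (rule that)
    \<comment> \<open>Vertices of \<open>L\<close> and \<open>H\<close> at distance \<open>d\<close>
      overlap in \<open>n - d\<close> letters; for \<open>d > n\<close> the common word is
      empty.\<close>
    show "factors c1 (n - d) \<inter> factors c2 (n - d) \<noteq> {}"
    proof -
      obtain k l where kl: "word_at x j n = word_at c2 k n" "word_at x (j + int d) n = word_at c1 l n"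
        using d unfolding factors_def by blast
      show ?thesis
      proof (cases "d \<le> n")
        case True
        have "word_at x (j + int d) (n - d) = word_at c2 (k + int d) (n - d)"
          by (rule word_at_eqD[OF kl(1)]) (use True in auto)
        moreover have "word_at x (j + int d + 0) (n - d) = word_at c1 (l + 0) (n - d)"
          by (rule word_at_eqD[OF kl(2)]) auto
        ultimately show ?thesis by (metis IntI empty_iff word_at_in_factors add.right_neutral)
      qed (auto simp: factors_def word_at_def)
    qed
    fix t assume t: "0 < t" "t < d + b"
    define N where "N = n + a - 1 + t"
    have "word_at x (p - int t) N = word_at x (q - int t) N"
      unfolding word_at_eq_iff
    proof (intro allI impI)
      fix i assume i: "i < N"
      show "x (p - int t + int i) = x (q - int t + int i)"
      proof (cases "i < t")
        case True
        then show ?thesis using bw[OF t(2)] unfolding word_at_eq_iff by simp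
      next
        case False
        then have "i - t < n + a - 1" using i by (simp add: N_def)
        then have "x (p + int (i - t)) = x (q + int (i - t))" using fw unfolding word_at_eq_iff by blast
        then show ?thesis using False by (simp add: of_nat_diff algebra_simps)
      qed
    qed
    moreover have "x (p - int t + int N) \<noteq> x (q - int t + int N)"
      using ne by (simp add: N_def algebra_simps)
    ultimately have "word_at x (p - int t) N \<in> right_special x N"
      unfolding right_special_def by auto
    then show "\<exists>i. word_at x i (n + a - 1 + t) \<in> right_special x (n + a - 1 + t) \<and>
       word_at x (i + int t - 1) n \<notin> H \<and> word_at x (i + int t + int a - 1) n \<in> H"
      using p(2) p(3)[of "a - 1"] p(1) unfolding N_def
      by (intro exI[of _ "p - int t"]) (auto simp: of_nat_diff algebra_simps)
  qed
qed

end

section \<open>Growth of the complexity\<close>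

lemma window_word_at: "k + n \<le> m \<Longrightarrow> take n (drop k (word_at y i m)) = word_at y (i + int k) n"
  by (rule nth_equalityI) (auto simp: algebra_simps)

lemma nat_growth:
  fixes f :: "nat \<Rightarrow> nat"
  assumes "\<And>m. p \<le> m \<Longrightarrow> m < q \<Longrightarrow> f m + s \<le> f (Suc m)" "p \<le> q"
  shows "f p + s * (q - p) \<le> f q"
  using assms(2,1)
proof (induction q rule: dec_induct)
  case (step q)
  then have "f p + s * (q - p) \<le> f q" "f q + s \<le> f (Suc q)" by auto
  then show ?case using step(1) by (simp add: Suc_diff_le)
qed simp

lemma two_right_special:
  assumes rec: "recurrent x" and fin: "finite (factors x (Suc n))"
    and c: "factors c (Suc n) \<subseteq> factors x (Suc n)" and d: "factors d (Suc n) \<subseteq> factors x (Suc n)"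
    and disj: "factors c n \<inter> factors d n = {}"
  obtains v w where "v \<in> factors c n" "v \<in> right_special x n" "w \<in> factors d n" "w \<in> right_special x n"
proof -
  have "word_at c 0 n \<in> factors x n" "word_at c 0 n \<notin> factors d n"
     "word_at d 0 n \<in> factors x n" "word_at d 0 n \<notin> factors c n"
    using factors_subset_mono[OF c, of n] factors_subset_mono[OF d, of n] disj by auto
  then show thesis
    using recurrent_right_special[OF rec c] recurrent_right_special[OF rec d] that by blast
qed

text \<open>\<open>extra_right_special\<close>, indexed by the length \<open>m\<close> of the word.
  The last vertex in \<open>H\<close> and another one outside \<open>H\<close> distinguish this word
  from right special words of walks that stay in one cycle.\<close>

lemma (in two_cycles) third_right_special:
  assumes a: "run_length x n H a" and b: "0 < b" "\<And>r. run_length x n L r \<Longrightarrow> b \<le> r"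
    and y: "factors y n \<subseteq> H" "factors y (n + a) \<subseteq> factors x (n + a)"
  obtains d where "factors c1 (n - d) \<inter> factors c2 (n - d) \<noteq> {}"
    "\<And>m. n + a \<le> m \<Longrightarrow> m + 1 < n + a + d + b \<Longrightarrow> \<exists>w \<in> right_special x m.
       take n (drop (m - n) w) \<in> H \<and> (\<exists>k. k + n \<le> m \<and> take n (drop k w) \<notin> H)"
proof -
  have "0 < a" using a by (simp add: run_length_def)
  obtain q where q: "word_at x (q - 1) n \<notin> H" "\<And>t. t \<le> a \<Longrightarrow> word_at x (q + int t) n \<in> H"
    using longer_run[OF y order_refl] by blast
  obtain d where d: "factors c1 (n - d) \<inter> factors c2 (n - d) \<noteq> {}"
    "\<And>t. 0 < t \<Longrightarrow> t < d + b \<Longrightarrow> \<exists>i. word_at x i (n + a - 1 + t) \<in> right_special x (n + a - 1 + t) \<and>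
       word_at x (i + int t - 1) n \<notin> H \<and> word_at x (i + int t + int a - 1) n \<in> H"
    by (rule extra_right_special[OF a q b]) blast+
  show thesis
  proof (rule that[OF d(1)])
    fix m assume m: "n + a \<le> m" "m + 1 < n + a + d + b"
    define t where "t = m + 1 - n - a"
    have t: "0 < t" "t < d + b" "n + a - 1 + t = m" using m \<open>0 < a\<close> by (auto simp: t_def)
    obtain i where i: "word_at x i m \<in> right_special x m"
      "word_at x (i + int t - 1) n \<notin> H" "word_at x (i + int t + int a - 1) n \<in> H"
      using d(2)[OF t(1,2)] unfolding t(3) by blast
    have "take n (drop (m - n) (word_at x i m)) = word_at x (i + int t + int a - 1) n"
      using t \<open>0 < a\<close> by (subst window_word_at) (auto simp: algebra_simps)
    moreover have "take n (drop (t - 1) (word_at x i m)) = word_at x (i + int t - 1) n"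
      using t \<open>0 < a\<close> by (subst window_word_at) (auto simp: algebra_simps of_nat_diff)
    moreover have "t - 1 + n \<le> m" using t by simp
    ultimately show "\<exists>w \<in> right_special x m.
       take n (drop (m - n) w) \<in> H \<and> (\<exists>k. k + n \<le> m \<and> take n (drop k w) \<notin> H)"
      using i by metis
  qed
qed

section \<open>Complexity in the presence of separated walks of all orders\<close>

text \<open>\<open>c m\<close> and \<open>d m\<close> are the two walks in the graph of order
  \<open>m\<close>. The condition \<open>sep\<close> compares walks of different orders, which makes
  it possible to locate \<open>c m\<close> relative to the cycles of a smaller order.\<close>

locale separated_cycles =
  fixes x :: "int \<Rightarrow> 'a" and c d :: "nat \<Rightarrow> int \<Rightarrow> 'a" and n0 K :: nat
  assumes rec: "recurrent x" and fin: "finite (factors x m)"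
    and walk_c: "n0 \<le> m \<Longrightarrow> factors (c m) (Suc m) \<subseteq> factors x (Suc m)"
    and walk_d: "n0 \<le> m \<Longrightarrow> factors (d m) (Suc m) \<subseteq> factors x (Suc m)"
    and K: "2 \<le> K"
    and sep: "n0 \<le> m \<Longrightarrow> n0 \<le> k \<Longrightarrow> m \<le> K * l \<Longrightarrow> k \<le> K * l \<Longrightarrow> factors (c m) l \<inter> factors (d k) l = {}"
begin

lemma swap: "separated_cycles x d c n0 K"
  using rec fin walk_c walk_d K sep unfolding separated_cycles_def by (metis inf_commute)

lemma disjoint: "n0 \<le> m \<Longrightarrow> factors (c m) m \<inter> factors (d m) m = {}"
  using sep[of m m m] K by simp

lemma growth_2:
  assumes "n0 \<le> m"
  shows "card (factors x m) + 2 \<le> card (factors x (Suc m))"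
proof -
  obtain v w where vw: "v \<in> factors (c m) m" "v \<in> right_special x m" "w \<in> factors (d m) m" "w \<in> right_special x m"
    by (rule two_right_special[OF rec fin walk_c[OF assms] walk_d[OF assms] disjoint[OF assms]])
  then have "v \<noteq> w" using disjoint[OF assms] by auto
  then show ?thesis using card_factors_Suc[of x m "{v, w}", OF fin] vw by simp
qed

text \<open>By \<open>stays_in_H\<close>, which asks for separation at length
  \<open>n + min b (m - n) - 1\<close>; \<open>m\<close> is at most \<open>K\<close> times this
  length, so \<open>sep\<close> applies.\<close>

lemma factors_in_cycle:
  assumes n: "n0 \<le> n" and tc: "two_cycles x (c n) (d n) n"
    and b: "0 < b" "\<And>r. run_length x n (factors (d n) n) r \<Longrightarrow> b \<le> r"
    and m: "n < m" "m \<le> K * (n + b - 1)"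
  shows "factors (c m) n \<subseteq> factors (c n) n"
proof (rule two_cycles.stays_in_H[OF tc m(1) _ b])
  show "factors (c m) m \<subseteq> factors x m"
    by (rule factors_subset_mono[OF walk_c]) (use n m in auto)
  have "1 \<le> n"
  proof (rule ccontr)
    assume "\<not> 1 \<le> n"
    then have "factors (c n) n \<inter> factors (d n) n \<noteq> {}" by (auto simp: factors_def word_at_def)
    then show False using disjoint[OF n] by simp
  qed
  \<comment> \<open>This serves the case \<open>m - n < b\<close>, where the separating length is
    \<open>m - 1\<close>.\<close>
  have "m \<le> K * (m - 1)"
  proof -
    have "m \<le> 2 * (m - 1)" using m \<open>1 \<le> n\<close> by simp
    also have "\<dots> \<le> K * (m - 1)" using K by (rule mult_le_mono1)
    finally show ?thesis .
  qed
  then have "m \<le> K * (n + min b (m - n) - 1)"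
    using m by (cases "b \<le> m - n") (auto simp: min_def)
  then show "factors (c m) (n + min b (m - n) - 1) \<inter> factors (d n) (n + min b (m - n) - 1) = {}"
    by (intro sep) (use n m in auto)
qed

text \<open>For a passage of length \<open>e\<close>, the overlap of its end vertices has length
  \<open>n - e\<close>. By \<open>sep\<close> it is below \<open>n / K\<close>, so passages cannot
  be much shorter than \<open>n\<close>.\<close>

lemma overlap_small:
  assumes "n0 \<le> n" "factors (c n) (n - e) \<inter> factors (d n) (n - e) \<noteq> {}"
  shows "K * (n - e) < n"
  using sep[OF assms(1) assms(1), of "n - e"] assms(2) by linarith

text \<open>\<open>R\<close> and \<open>S\<close> are the lengths of the words spelled by the
  shortest stays. Up to length \<open>K * R\<close> there are two right special words, a third one
  from \<open>R\<close> to about \<open>R + S\<close>, and a fourth one from \<open>S\<close> to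
  about \<open>R + S\<close>. The conclusion says that the complexity at \<open>N\<close> is at
  least \<open>(3 - 1 / K) * N\<close> up to a constant, multiplied by \<open>K\<close> to stay
  within the natural numbers.\<close>

lemma linear_growth:
  assumes n: "n0 \<le> n" and tc: "two_cycles x (c n) (d n) n"
    and a: "run_length x n (factors (c n) n) a" "\<And>r. run_length x n (factors (c n) n) r \<Longrightarrow> a \<le> r"
    and b: "run_length x n (factors (d n) n) b" "\<And>r. run_length x n (factors (d n) n) r \<Longrightarrow> b \<le> r"
    and ab: "a \<le> b"
  shows "\<exists>N\<ge>n. 3 * K * N \<le> K * card (factors x N) + N + K * (2 * n0 + 1)"
proof -
  interpret sw: separated_cycles x d c n0 K by (rule swap)
  let ?H = "factors (c n) n" and ?L = "factors (d n) n"
  let ?p = "\<lambda>m. card (factors x m)"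
  note tc' = two_cycles_swap[OF tc]
  define R where "R = n + a - 1"
  define S where "S = n + b - 1"
  have pos: "0 < a" "0 < b" using a b by (auto simp: run_length_def)
  have RS: "n \<le> R" "R \<le> S" using pos ab by (auto simp: R_def S_def)
  have n1: "0 < n"
    using disjoint[OF n] by (intro Nat.gr0I) (auto simp: factors_def word_at_def)
  have KR: "R < K * R" "K * R \<le> K * S"
  proof -
    have "R < 2 * R" using n1 RS by simp
    also have "\<dots> \<le> K * R" using K by (rule mult_le_mono1)
    finally show "R < K * R" .
  qed (use RS in simp)
  have inH: "factors (c m) n \<subseteq> ?H" and inL: "factors (d m) n \<subseteq> ?L" if "n < m" "m \<le> K * R" for m
  proof -
    have "m \<le> K * S" using that(2) KR(2) by (rule le_trans)
    then show "factors (c m) n \<subseteq> ?H"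
      by (intro factors_in_cycle[OF n tc pos(2)] b(2) that(1)) (auto simp: S_def)
    show "factors (d m) n \<subseteq> ?L"
      using that(2) by (intro sw.factors_in_cycle[OF n tc' pos(1)] a(2) that(1)) (auto simp: R_def)
  qed
  have cx: "factors (c m) m \<subseteq> factors x m" and dx: "factors (d m) m \<subseteq> factors x m" if "n0 \<le> m" for m
    using factors_subset_mono[OF walk_c[OF that], of m] factors_subset_mono[OF walk_d[OF that], of m] by auto
  have na: "n + a = R + 1" and nb: "n + b = S + 1" using pos by (auto simp: R_def S_def)
  obtain e where e: "factors (c n) (n - e) \<inter> factors (d n) (n - e) \<noteq> {}"
    "\<And>m. n + a \<le> m \<Longrightarrow> m + 1 < n + a + e + b \<Longrightarrow> \<exists>w \<in> right_special x m.
       take n (drop (m - n) w) \<in> ?H \<and> (\<exists>k. k + n \<le> m \<and> take n (drop k w) \<notin> ?H)"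
    by (rule two_cycles.third_right_special[OF tc a(1) pos(2) b(2), of "c (n + a)"])
      (use inH[of "n + a"] cx[of "n + a"] n pos na KR in auto)
  have Ke: "K * (n - e) < n" by (rule overlap_small[OF n e(1)])
  \<comment> \<open>Up to length \<open>K * R\<close> the walks \<open>c m\<close> and
    \<open>d m\<close> remain in the cycles of order \<open>n\<close>; this locates all windows of
    length \<open>n\<close> of their right special words.\<close>
  have two: "\<exists>v w. v \<in> right_special x m \<and> w \<in> right_special x m \<and>
     (\<forall>k. k + n \<le> m \<longrightarrow> take n (drop k v) \<in> ?H \<and> take n (drop k w) \<in> ?L)" if m: "n < m" "m \<le> K * R" for m
  proof -
    have "n0 \<le> m" using m n by simp
    obtain v w where vw: "v \<in> factors (c m) m" "v \<in> right_special x m" "w \<in> factors (d m) m" "w \<in> right_special x m"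
      by (rule two_right_special[OF rec fin walk_c[OF \<open>n0 \<le> m\<close>] walk_d[OF \<open>n0 \<le> m\<close>] disjoint[OF \<open>n0 \<le> m\<close>]])
    have "take n (drop k v) \<in> ?H \<and> take n (drop k w) \<in> ?L" if "k + n \<le> m" for k
    proof -
      have "take n (drop k v) \<in> factors (c m) n" "take n (drop k w) \<in> factors (d m) n"
        using vw(1,3) window_word_at[OF that] unfolding factors_def by fastforce+
      then show ?thesis using inH[OF m] inL[OF m] by blast
    qed
    then show ?thesis using vw by blast
  qed
  have disj: "?H \<inter> ?L = {}" by (rule disjoint[OF n])
  \<comment> \<open>In terms of \<open>R\<close> and \<open>S\<close>, the range of the third word
    ends at \<open>R + S\<close>, diminished by the overlap \<open>n - e\<close>.\<close>
  have growth_3: "?p m + 3 \<le> ?p (Suc m)" if m: "R < m" "m \<le> K * R" "m + (n - e) \<le> R + S" for m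
  proof -
    have nm: "n < m" using m RS by simp
    obtain v w where vw: "v \<in> right_special x m" "w \<in> right_special x m"
     "\<And>k. k + n \<le> m \<Longrightarrow> take n (drop k v) \<in> ?H \<and> take n (drop k w) \<in> ?L"
      using two[OF nm m(2)] by blast
    have "m + 1 < n + a + e + b" using m(3) n1 na nb by linarith
    then obtain u where u: "u \<in> right_special x m" "take n (drop (m - n) u) \<in> ?H"
        "\<exists>k. k + n \<le> m \<and> take n (drop k u) \<notin> ?H"
      using e(2)[of m] m na by auto
    have "v \<noteq> w" "u \<noteq> v" "u \<noteq> w" using vw(3)[of "m - n"] vw(3) u nm disj by auto
    then have "card {u, v, w} = 3" by simp
    then show ?thesis using card_factors_Suc[of x m "{u, v, w}", OF fin] vw u by simp
  qed
  show ?thesis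
  proof (cases "K * R \<le> R + S - (n - e) \<or> K * R \<le> S")
    \<comment> \<open>\<open>S\<close> is much larger than \<open>R\<close>. The third word is
      present from \<open>R + 1\<close> up to \<open>K * R\<close>, so that at
      \<open>N = K * R\<close> only about \<open>R\<close> is lost against
      \<open>3 * N\<close>.\<close>
    case True
    have "n - e \<le> n" by simp
    then have le: "R + S - (n - e) \<ge> S" using RS by linarith
    then have KRS: "K * R \<le> R + S - (n - e)" using True by linarith
    have 1: "?p n0 + 2 * (R + 1 - n0) \<le> ?p (R + 1)"
      by (rule nat_growth) (use growth_2 n RS in auto)
    have 2: "?p (R + 1) + 3 * (K * R - (R + 1)) \<le> ?p (K * R)"
    proof (rule nat_growth)
      show "R + 1 \<le> K * R" using KR(1) by linarith
    qed (use growth_3 KRS in auto)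
    have "3 * (K * R) \<le> ?p (K * R) + R + (2 * n0 + 1)"
      using 1 2 KR n RS by linarith
    then have "K * (3 * (K * R)) \<le> K * (?p (K * R) + R + (2 * n0 + 1))" by (rule mult_le_mono2)
    moreover have "n \<le> K * R" using KR(1) RS by linarith
    ultimately show ?thesis
      by (intro exI[of _ "K * R"]) (simp add: algebra_simps)
  next
    case False
    then have SK: "S + 1 \<le> K * R" by simp
    obtain f where f: "factors (d n) (n - f) \<inter> factors (c n) (n - f) \<noteq> {}"
      "\<And>m. n + b \<le> m \<Longrightarrow> m + 1 < n + b + f + a \<Longrightarrow> \<exists>w \<in> right_special x m.
         take n (drop (m - n) w) \<in> ?L \<and> (\<exists>k. k + n \<le> m \<and> take n (drop k w) \<notin> ?L)"
      by (rule two_cycles.third_right_special[OF tc' b(1) pos(1) a(2), of "d (n + b)"])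
        (use inL[of "n + b"] dx[of "n + b"] n pos nb SK in auto)
    have Kf: "K * (n - f) < n" by (rule sw.overlap_small[OF n f(1)])
    \<comment> \<open>The larger overlap of the two passages. Both extra right special words are
      available up to length \<open>R + S - g\<close>.\<close>
    define g where "g = max (n - e) (n - f)"
    have Kg: "K * g < n" using Ke Kf by (auto simp: g_def max_def)
    have gn: "g \<le> n" by (simp add: g_def)
    define N where "N = R + S - g"
    have N: "S \<le> N" "N + g = R + S" "N \<le> K * R"
      using gn RS False unfolding N_def g_def by auto
    have growth_4: "?p m + 4 \<le> ?p (Suc m)" if m: "S < m" "m \<le> N" for m
    proof -
      have nm: "n < m" "m \<le> K * R" using m N RS by simp_all
      obtain v w where vw: "v \<in> right_special x m" "w \<in> right_special x m"
       "\<And>k. k + n \<le> m \<Longrightarrow> take n (drop k v) \<in> ?H \<and> take n (drop k w) \<in> ?L"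
        using two[OF nm] by blast
      have ge: "n - e \<le> g" "n - f \<le> g" by (simp_all add: g_def)
      have "m + 1 < n + a + e + b" using m(2) N(2) ge n1 na nb by linarith
      then obtain u where u: "u \<in> right_special x m" "take n (drop (m - n) u) \<in> ?H"
          "\<exists>k. k + n \<le> m \<and> take n (drop k u) \<notin> ?H"
        using e(2)[of m] m na RS by auto
      have "m + 1 < n + b + f + a" using m(2) N(2) ge n1 na nb by linarith
      then obtain z where z: "z \<in> right_special x m" "take n (drop (m - n) z) \<in> ?L"
          "\<exists>k. k + n \<le> m \<and> take n (drop k z) \<notin> ?L"
        using f(2)[of m] m nb by auto
      have "take n (drop (m - n) v) \<in> ?H" "take n (drop (m - n) w) \<in> ?L"
        using vw(3)[of "m - n"] nm by auto
      then have "v \<noteq> w" "u \<noteq> w" "z \<noteq> v" "z \<noteq> u" using u(2) z(2) disj by auto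
      moreover have "u \<noteq> v" "z \<noteq> w" using vw(3) u(3) z(3) by blast+
      ultimately have "card {u, v, w, z} = 4" by simp
      then show ?thesis using card_factors_Suc[of x m "{u, v, w, z}", OF fin] vw u z by simp
    qed
    \<comment> \<open>These count the lengths with at least two, three and four right special words.
      As \<open>B = S - R\<close> and \<open>C = R - g\<close>, the sum
      \<open>2 * A + 3 * B + 4 * C\<close> is \<open>3 * N - g\<close> up to a constant, and
      \<open>g\<close> is below \<open>n / K\<close>.\<close>
    define A B C where "A = R + 1 - n0" and "B = S + 1 - (R + 1)" and "C = N + 1 - (S + 1)"
    have ABC: "A + n0 = R + 1" "B + R = S" "C + S = N"
      using N n RS by (simp_all add: A_def B_def C_def)
    have 1: "?p n0 + 2 * A \<le> ?p (R + 1)"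
      unfolding A_def by (rule nat_growth) (use growth_2 n RS in auto)
    have ge: "n - e \<le> g" by (simp add: g_def)
    have 2: "?p (R + 1) + 3 * B \<le> ?p (S + 1)"
      unfolding B_def by (rule nat_growth) (use growth_3 N ge SK RS in auto)
    have 3: "?p (S + 1) + 4 * C \<le> ?p (N + 1)"
      unfolding C_def by (rule nat_growth) (use growth_4 N in auto)
    have "2 * A + 3 * B + 4 * C \<le> ?p (N + 1)" using 1 2 3 by linarith
    moreover have "g + C = R" using N(2) ABC by linarith
    ultimately have "3 * C + 3 * B + 3 * R + 3 \<le> ?p (N + 1) + g + 2 * n0 + 1"
      using ABC(1) by linarith
    then have "3 * (N + 1) \<le> ?p (N + 1) + g + (2 * n0 + 1)"
      unfolding ABC(2,3)[symmetric] by (simp add: algebra_simps)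
    then have "K * (3 * (N + 1)) \<le> K * (?p (N + 1) + g + (2 * n0 + 1))" by (rule mult_le_mono2)
    also have "\<dots> = K * ?p (N + 1) + K * g + K * (2 * n0 + 1)" by (simp add: algebra_simps)
    also have "\<dots> \<le> K * ?p (N + 1) + (N + 1) + K * (2 * n0 + 1)" using Kg N RS by simp
    finally show ?thesis
      using N RS by (intro exI[of _ "N + 1"]) (auto simp: algebra_simps)
  qed
qed

text \<open>Growth by three at all large lengths would exceed \<open>(3 - \<epsilon>) * m\<close>,
  so there is a large \<open>n\<close> with growth at most two. Then \<open>linear_growth\<close>
  yields \<open>K * \<epsilon> * N \<le> N + K * (2 * n0 + 1) < 2 * N\<close>, against
  \<open>4 \<le> K * \<epsilon>\<close>.\<close>

theorem complexity_contradiction: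
  assumes eps: "0 < \<epsilon>" "4 \<le> real K * \<epsilon>"
    and le: "\<And>m. n0 \<le> m \<Longrightarrow> real (card (factors x m)) \<le> (3 - \<epsilon>) * real m"
  shows False
proof -
  \<comment> \<open>Large enough for the additive constant of \<open>linear_growth\<close> to be
    smaller than \<open>N\<close>.\<close>
  define n1 where "n1 = K * (2 * n0 + 1) + 1"
  have "n0 \<le> n1"
    using mult_le_mono1[OF K, of "2 * n0 + 1"] by (simp add: n1_def)
  have "\<exists>n\<ge>n1. card (factors x (Suc n)) \<le> card (factors x n) + 2"
  proof (rule ccontr)
    assume *: "\<not> ?thesis"
    \<comment> \<open>Beyond \<open>3 * n1 / \<epsilon>\<close> the number
      \<open>3 * (n - n1)\<close> exceeds \<open>(3 - \<epsilon>) * n\<close>.\<close>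
    define n where "n = n1 + nat \<lceil>3 * real n1 / \<epsilon>\<rceil> + 1"
    have "3 * real n1 / \<epsilon> < real n" unfolding n_def by linarith
    then have "3 * real n1 < \<epsilon> * real n" using eps by (simp add: field_simps)
    have "n1 \<le> n" by (simp add: n_def)
    have "card (factors x n1) + 3 * (n - n1) \<le> card (factors x n)"
      by (rule nat_growth) (use * \<open>n1 \<le> n\<close> in force)+
    then have "3 * (n - n1) \<le> card (factors x n)" by simp
    then have "real (3 * (n - n1)) \<le> real (card (factors x n))" by (rule of_nat_mono)
    then have "3 * (real n - real n1) \<le> real (card (factors x n))"
      using \<open>n1 \<le> n\<close> by (simp add: of_nat_diff)
    also have "\<dots> \<le> (3 - \<epsilon>) * real n" by (rule le) (use \<open>n0 \<le> n1\<close> \<open>n1 \<le> n\<close> in simp)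
    finally show False using \<open>3 * real n1 < \<epsilon> * real n\<close> by (simp add: algebra_simps)
  qed
  then obtain n where n: "n1 \<le> n" "card (factors x (Suc n)) \<le> card (factors x n) + 2" by blast
  then have "n0 \<le> n" using \<open>n0 \<le> n1\<close> by simp
  interpret sw: separated_cycles x d c n0 K by (rule swap)
  interpret tc: two_cycles x "c n" "d n" n
    by unfold_locales (use rec fin walk_c walk_d disjoint \<open>n0 \<le> n\<close> n in auto)
  interpret tc': two_cycles x "d n" "c n" n by (rule two_cycles_swap) unfold_locales
  obtain r where r: "run_length x n (factors (c n) n) r" by (rule tc.finite_run)
  obtain s where s: "run_length x n (factors (d n) n) s" by (rule tc'.finite_run)
  define a where "a = (LEAST r. run_length x n (factors (c n) n) r)"
  define b where "b = (LEAST r. run_length x n (factors (d n) n) r)"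
  have a: "run_length x n (factors (c n) n) a" "\<And>r. run_length x n (factors (c n) n) r \<Longrightarrow> a \<le> r"
    unfolding a_def by (rule LeastI, rule r) (rule Least_le)
  have b: "run_length x n (factors (d n) n) b" "\<And>r. run_length x n (factors (d n) n) r \<Longrightarrow> b \<le> r"
    unfolding b_def by (rule LeastI, rule s) (rule Least_le)
  have "\<exists>N\<ge>n. 3 * K * N \<le> K * card (factors x N) + N + K * (2 * n0 + 1)"
  proof (cases "a \<le> b")
    case True
    show ?thesis by (rule linear_growth[OF \<open>n0 \<le> n\<close> tc.two_cycles_axioms a b True])
  next
    case False
    then have "b \<le> a" by simp
    show ?thesis by (rule sw.linear_growth[OF \<open>n0 \<le> n\<close> tc'.two_cycles_axioms b a \<open>b \<le> a\<close>])
  qed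
  then obtain N where N: "n \<le> N" "3 * K * N \<le> K * card (factors x N) + N + K * (2 * n0 + 1)" by blast
  have "real (3 * K * N) \<le> real (K * card (factors x N) + N + K * (2 * n0 + 1))"
    using N(2) by (rule of_nat_mono)
  then have "3 * real K * real N \<le> real K * real (card (factors x N)) + real N + real (K * (2 * n0 + 1))"
    by simp
  also have "real K * real (card (factors x N)) \<le> real K * ((3 - \<epsilon>) * real N)"
    by (intro mult_left_mono le) (use \<open>n0 \<le> n\<close> N in auto)
  finally have "real K * \<epsilon> * real N \<le> real N + real (K * (2 * n0 + 1))"
    by (simp add: algebra_simps)
  moreover have "4 * real N \<le> real K * \<epsilon> * real N" using eps by (intro mult_right_mono) auto
  moreover have "real (K * (2 * n0 + 1)) < real N" using n N by (simp add: n1_def flip: of_nat_less_iff del: of_nat_mult of_nat_add)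
  ultimately show False by linarith
qed

end

section \<open>Cycles with extremal frequencies\<close>

text \<open>Simple closed walks, each of average weight at most \<open>\<beta>\<close>, are cut out
  of \<open>ws\<close> one by one. There remains a simple path with at most \<open>card V\<close>
  vertices, which accounts for the additive constant.\<close>

lemma simple_cycle_bound:
  fixes g :: "'v \<Rightarrow> real"
  assumes fin: "finite V" and g1: "\<And>v. g v \<le> 1"
    and cyc: "\<And>vs. vs \<noteq> [] \<Longrightarrow> set vs \<subseteq> V \<Longrightarrow> distinct vs \<Longrightarrow> successively R vs \<Longrightarrow>
      R (last vs) (hd vs) \<Longrightarrow> sum_list (map g vs) \<le> \<beta> * real (length vs)"
    and ws: "set ws \<subseteq> V" "successively R ws"
  shows "sum_list (map g ws) \<le> \<beta> * real (length ws) + (1 + \<bar>\<beta>\<bar>) * real (card V)"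
  using ws
proof (induction "length ws" arbitrary: ws rule: less_induct)
  case less
  show ?case
  proof (cases "distinct ws")
    case True
    have len: "length ws \<le> card V"
      using card_mono[OF fin less.prems(1)] distinct_card[OF True] by simp
    have "sum_list (map g ws) \<le> sum_list (map (\<lambda>_. 1) ws)"
      by (rule sum_list_mono) (rule g1)
    also have "\<dots> = real (length ws)" by (induction ws) auto
    also have "\<dots> \<le> \<beta> * real (length ws) + (1 + \<bar>\<beta>\<bar>) * real (length ws)"
    proof -
      have "0 \<le> (\<beta> + \<bar>\<beta>\<bar>) * real (length ws)" by (intro mult_nonneg_nonneg) auto
      then show ?thesis by (simp add: algebra_simps)
    qed
    also have "\<dots> \<le> \<beta> * real (length ws) + (1 + \<bar>\<beta>\<bar>) * real (card V)"
      using len by (intro add_left_mono mult_left_mono) auto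
    finally show ?thesis .
  next
    case False
    \<comment> \<open>This \<open>y\<close> is the first vertex to be repeated, so the part from its
      earlier visit up to it is a simple closed walk.\<close>
    then obtain xs y ys where xs: "y \<in> set xs" "distinct xs" "ws = xs @ y # ys"
      by (auto simp: not_distinct_conv_prefix)
    obtain a b where ab: "xs = a @ y # b" using xs(1) by (auto simp: in_set_conv_decomp)
    have ws: "ws = a @ (y # b) @ (y # ys)" using xs ab by simp
    have succ: "successively R (y # b)" "R (last (y # b)) y" "successively R (a @ y # ys)"
    proof -
      have "successively R a" "successively R ((y # b) @ (y # ys))" "a \<noteq> [] \<longrightarrow> R (last a) y"
        using less.prems(2) unfolding ws by (auto simp: successively_append_iff)
      moreover from this(2) show "successively R (y # b)" "R (last (y # b)) y"
        unfolding successively_append_iff by simp_all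
      ultimately show "successively R (a @ y # ys)"
        unfolding successively_append_iff by auto
    qed
    have "sum_list (map g (y # b)) \<le> \<beta> * real (length (y # b))"
      by (rule cyc) (use succ xs ab less.prems(1) ws in auto)
    moreover have "sum_list (map g (a @ y # ys)) \<le> \<beta> * real (length (a @ y # ys)) + (1 + \<bar>\<beta>\<bar>) * real (card V)"
      by (rule less.hyps) (use succ less.prems(1) ws in auto)
    ultimately show ?thesis unfolding ws by (simp add: algebra_simps)
  qed
qed

section \<open>Window sums along sequences and periodic walks\<close>

text \<open>For the indicator of a word of length \<open>q\<close> this counts its occurrences at
  \<open>n\<close> consecutive positions.\<close>

definition window_sum :: "('a list \<Rightarrow> real) \<Rightarrow> nat \<Rightarrow> (int \<Rightarrow> 'a) \<Rightarrow> int \<Rightarrow> nat \<Rightarrow> real" where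
  "window_sum f q y i n = (\<Sum>t<n. f (word_at y (i + int t) q))"

lemma window_sum_0 [simp]: "window_sum f q y i 0 = 0"
  by (simp add: window_sum_def)

lemma window_sum_add:
  "window_sum f q y i (m + n) = window_sum f q y i m + window_sum f q y (i + int m) n"
  by (induction n) (auto simp: window_sum_def algebra_simps)

lemma window_sum_cong:
  assumes "word_at y i (n + q) = word_at z j (n + q)"
  shows "window_sum f q y i n = window_sum f q z j n"
  unfolding window_sum_def
  by (intro sum.cong refl arg_cong[of _ _ f] word_at_eqD[OF assms]) auto

lemma window_sum_complement:
  "window_sum (\<lambda>w. 1 - f w) q y i n = real n - window_sum f q y i n"
  by (simp add: window_sum_def sum_subtractf)

lemma window_sum_le_length:
  assumes "\<And>w. f w \<le> 1"
  shows "window_sum f q y i n \<le> real n"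
  using sum_mono[of "{..<n}" "\<lambda>t. f (word_at y (i + int t) q)" "\<lambda>_. 1"] assms
  by (simp add: window_sum_def)

text \<open>Blocks of length \<open>N\<close> are split off; the remainder is shorter than
  \<open>N\<close> and contributes at most \<open>N\<close>.\<close>

lemma window_sum_chunks:
  assumes f1: "\<And>w. f w \<le> 1" and N: "0 < N" "\<And>i. window_sum f q y i N \<le> B * real N" and B: "0 \<le> B"
  shows "window_sum f q y i n \<le> B * real n + real N"
proof (induction n arbitrary: i rule: less_induct)
  case (less n)
  show ?case
  proof (cases "n < N")
    case True
    then have "window_sum f q y i n \<le> real N" using window_sum_le_length[of f q y i n, OF f1] by linarith
    then show ?thesis using B by (simp add: add_increasing)
  next
    case False
    then have "window_sum f q y i n = window_sum f q y i N + window_sum f q y (i + int N) (n - N)"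
      by (simp flip: window_sum_add)
    moreover have "window_sum f q y (i + int N) (n - N) \<le> B * real (n - N) + real N"
      by (rule less) (use N False in auto)
    ultimately show ?thesis using N(2)[of i] False by (simp add: of_nat_diff algebra_simps)
  qed
qed

text \<open>\<open>c\<close> reads the first letters of the vertices, going round the closed walk
  forever. Since consecutive vertices overlap in all but one letter, the word of length
  \<open>M\<close> at each position is the vertex itself.\<close>

lemma sequence_of_cycle:
  fixes vs :: "'a list list"
  assumes "vs \<noteq> []" and len: "\<And>v. v \<in> set vs \<Longrightarrow> length v = M" and "0 < M"
    and succ: "successively (\<lambda>u v. tl u = butlast v) vs" and close: "tl (last vs) = butlast (hd vs)"
  shows "\<exists>c. (\<forall>i. c (i + int (length vs)) = c i) \<and> factors c M = set vs \<and>
    (\<forall>t<length vs. word_at c (int t) M = vs ! t)"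
proof -
  define l where "l = length vs"
  have l: "0 < l" using assms(1) by (simp add: l_def)
  define u where "u i = vs ! nat (i mod int l)" for i
  define c where "c i = u i ! 0" for i
  have idx: "nat (i mod int l) < l" for i using l by (simp add: nat_less_iff)
  have ulen: "length (u i) = M" for i unfolding u_def using idx len by (simp add: l_def)
  have step: "tl (u i) = butlast (u (i + 1))" for i
  proof (cases "nat (i mod int l) + 1 < l")
    case True
    then have "i mod int l + 1 < int l" by linarith
    then have "(i + 1) mod int l = i mod int l + 1"
      using l by (metis add.commute mod_add_right_eq mod_pos_pos_trivial pos_mod_sign of_nat_0_less_iff add_increasing zero_le_one)
    then have "nat ((i + 1) mod int l) = Suc (nat (i mod int l))"
      using l by (simp add: nat_add_distrib)
    then show ?thesis
      using succ True unfolding u_def successively_conv_nth l_def by simp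
  next
    case False
    then have il: "nat (i mod int l) = l - 1" using idx[of i] by simp
    moreover have "int (nat (i mod int l)) = i mod int l" using l by simp
    ultimately have im: "i mod int l = int l - 1" using l by (simp add: of_nat_diff)
    then have "(i + 1) mod int l = 0"
      by (metis mod_add_left_eq diff_add_cancel mod_self)
    then show ?thesis using il close assms(1) unfolding u_def
      by (simp add: l_def last_conv_nth hd_conv_nth)
  qed
  have shift: "u (i + int k) ! j = u i ! (j + k)" if "j + k < M" for i j k
    using that
  proof (induction k arbitrary: j)
    case (Suc k)
    have "u (i + int k + 1) ! j = butlast (u (i + int k + 1)) ! j"
      using Suc.prems ulen by (simp add: nth_butlast)
    also have "\<dots> = tl (u (i + int k)) ! j" by (simp add: step)
    also have "\<dots> = u (i + int k) ! Suc j"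
      using Suc.prems ulen by (simp add: nth_tl)
    also have "\<dots> = u i ! (Suc j + k)" by (rule Suc.IH) (use Suc.prems in simp)
    finally show ?case by (simp add: algebra_simps)
  qed simp
  have word: "word_at c i M = u i" for i
    by (rule nth_equalityI) (use ulen shift[of 0 _ i] in \<open>auto simp: c_def\<close>)
  have "word_at c (int t) M = vs ! t" if "t < length vs" for t
    using that unfolding word u_def l_def by simp
  moreover have "c (i + int l) = c i" for i unfolding c_def u_def by simp
  moreover have "factors c M = set vs"
  proof
    show "factors c M \<subseteq> set vs"
      using idx by (auto simp: factors_def word u_def l_def)
    show "set vs \<subseteq> factors c M"
      using calculation(1) by (metis in_set_conv_nth subsetI word_at_in_factors)
  qed
  ultimately show ?thesis unfolding l_def by blast
qed

lemma periodic_shift: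
  fixes c :: "int \<Rightarrow> 'a"
  assumes "\<And>i. c (i + p) = c i"
  shows "c (i + a * p) = c i"
proof -
  have *: "c (i + int n * p) = c i" for n i
  proof (induction n)
    case (Suc n)
    then show ?case using assms[of "i + int n * p"] by (simp add: algebra_simps)
  qed simp
  show ?thesis
  proof (cases "0 \<le> a")
    case True
    then show ?thesis using *[of i "nat a"] by simp
  next
    case False
    then show ?thesis using *[of "i + a * p" "nat (- a)"] by simp
  qed
qed

text \<open>The window is padded on both sides to whole periods, whose average is at least
  \<open>b - \<delta>\<close>. The padding has total length at most \<open>2 * l\<close> and average
  at most \<open>b + \<delta>\<close>, up to an error \<open>N\<close> on each side, so the rest of
  the sum must come from the window.\<close>

lemma window_sum_periodic_ge:
  assumes f1: "\<And>w. f w \<le> 1" and per: "\<And>i. c (i + int l) = c i" and l: "0 < l"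
    and mean: "(b - \<delta>) * real l \<le> window_sum f q c 0 l"
    and N: "0 < N" "\<And>i. window_sum f q c i N \<le> (b + \<delta>) * real N"
    and b: "0 \<le> b" and \<delta>: "0 \<le> \<delta>"
  shows "b * real n - \<delta> * real n - 4 * \<delta> * real l - 2 * real N \<le> window_sum f q c i n"
proof -
  define W where "W = window_sum f q c 0 l"
  have shift: "window_sum f q c (j + a * int l) m = window_sum f q c j m" for j a m
  proof (rule window_sum_cong)
    have "c (j + a * int l + int t) = c (j + int t)" for t
      using periodic_shift[of c "int l" "j + int t" a, OF per] by (simp add: algebra_simps)
    then show "word_at c (j + a * int l) (m + q) = word_at c j (m + q)" by (simp add: word_at_eq_iff)
  qed
  have total: "window_sum f q c 0 (k * l) = real k * W" for k
  proof (induction k)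
    case (Suc k)
    have "window_sum f q c 0 (k * l + l) = window_sum f q c 0 (k * l) + window_sum f q c (0 + int k * int l) l"
      by (simp add: window_sum_add)
    then show ?case using Suc shift[of 0 "int k" l] by (simp add: W_def algebra_simps)
  qed simp
  define r where "r = nat (i mod int l)"
  define k where "k = (r + n) div l + 1"
  define s where "s = k * l - (r + n)"
  have r: "int r = i mod int l" "r < l" using l by (simp_all add: r_def nat_less_iff)
  have i: "i = int r + (i div int l) * int l" using r by simp
  have kl: "(r + n) div l * l \<le> r + n" "r + n < (r + n) div l * l + l"
    using l div_mult_mod_eq[of "r + n" l] mod_less_divisor[OF l, of "r + n"] by linarith+
  have ks: "r + n + s = k * l" "k * l \<le> r + n + l" using kl by (simp_all add: k_def s_def)
  have "window_sum f q c i n = window_sum f q c (int r) n"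
    by (subst i) (rule shift)
  moreover have "window_sum f q c 0 (k * l) =
      window_sum f q c 0 r + window_sum f q c (int r) n + window_sum f q c (int (r + n)) s"
    unfolding ks(1)[symmetric] by (simp add: window_sum_add)
  moreover have "window_sum f q c 0 r \<le> (b + \<delta>) * real r + real N"
    "window_sum f q c (int (r + n)) s \<le> (b + \<delta>) * real s + real N"
    using window_sum_chunks[of f N q c "b + \<delta>", OF f1 N] b \<delta> by simp_all
  moreover have "real k * ((b - \<delta>) * real l) \<le> real k * W"
    using mean by (intro mult_left_mono) (auto simp: W_def)
  moreover have "real r + real n + real s = real k * real l"
    using ks(1) by (metis of_nat_add of_nat_mult)
  ultimately have "(b - \<delta>) * (real r + real n + real s) - (b + \<delta>) * (real r + real s) - 2 * real N
      \<le> window_sum f q c i n"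
    using total[of k] by (simp add: algebra_simps)
  moreover have "real r + real s \<le> 2 * real l" using r ks by linarith
  then have "\<delta> * (real r + real s) \<le> \<delta> * (2 * real l)" using \<delta> by (rule mult_left_mono)
  ultimately show ?thesis by (simp add: algebra_simps)
qed

section \<open>Maximal frequencies and closed walks that nearly attain them\<close>

text \<open>This is the infimum over \<open>n > 0\<close> of the supremum of the averages over
  windows of length \<open>n\<close>; by subadditivity it is also the limit. Any larger number
  therefore bounds the averages of all windows of one length \<open>N\<close>.\<close>

definition max_mean :: "('a list \<Rightarrow> real) \<Rightarrow> nat \<Rightarrow> (int \<Rightarrow> 'a) \<Rightarrow> real" where
  "max_mean f q x = Sup {\<beta>. \<forall>n. \<exists>i. \<beta> * real n \<le> window_sum f q x i n}"

context
  fixes f :: "'a list \<Rightarrow> real" and q :: nat and x :: "int \<Rightarrow> 'a"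
  assumes f: "\<And>w. 0 \<le> f w" "\<And>w. f w \<le> 1"
begin

lemma max_mean_bdd: "bdd_above {\<beta>. \<forall>n. \<exists>i. \<beta> * real n \<le> window_sum f q x i n}"
proof (rule bdd_aboveI)
  fix \<beta> assume "\<beta> \<in> {\<beta>. \<forall>n. \<exists>i. \<beta> * real n \<le> window_sum f q x i n}"
  then obtain i where "\<beta> * real 1 \<le> window_sum f q x i 1" by blast
  also have "\<dots> \<le> real 1" by (rule window_sum_le_length) (rule f)
  finally show "\<beta> \<le> 1" by simp
qed

lemma le_max_mean: "(\<And>n. \<exists>i. \<beta> * real n \<le> window_sum f q x i n) \<Longrightarrow> \<beta> \<le> max_mean f q x"
  unfolding max_mean_def by (rule cSup_upper[OF _ max_mean_bdd]) simp

lemma max_mean_nonneg: "0 \<le> max_mean f q x"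
  by (rule le_max_mean) (auto simp: window_sum_def intro!: sum_nonneg f)

lemma max_mean_lower:
  assumes "\<beta> < max_mean f q x"
  shows "\<exists>i. \<beta> * real n \<le> window_sum f q x i n"
proof -
  have "0 \<in> {\<beta>. \<forall>n. \<exists>i. \<beta> * real n \<le> window_sum f q x i n}"
    by (auto simp: window_sum_def intro!: sum_nonneg f)
  then obtain \<gamma> where \<gamma>: "\<beta> < \<gamma>" "\<forall>n. \<exists>i. \<gamma> * real n \<le> window_sum f q x i n"
    using less_cSupD[of "{\<beta>. \<forall>n. \<exists>i. \<beta> * real n \<le> window_sum f q x i n}" \<beta>] assms
    unfolding max_mean_def by blast
  have "\<beta> * real n \<le> \<gamma> * real n" using \<gamma> by (intro mult_right_mono) auto
  then show ?thesis using \<gamma>(2) by (meson order_trans)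
qed

lemma max_mean_upper:
  assumes "max_mean f q x < \<beta>"
  shows "\<exists>N>0. \<forall>i. window_sum f q x i N \<le> \<beta> * real N"
proof -
  obtain N where N: "\<And>i. window_sum f q x i N < \<beta> * real N"
    using le_max_mean[of \<beta>] assms by (meson not_le)
  then have "N \<noteq> 0" using N[of 0] by (intro notI) simp
  then show ?thesis using N by (meson less_imp_le not_gr_zero)
qed

text \<open>If all simple closed walks of the graph of order \<open>M\<close> had average below
  \<open>\<beta>\<close>, \<open>simple_cycle_bound\<close> would bound every window sum of
  \<open>x\<close> by \<open>\<beta> * n + C\<close>. For \<open>\<gamma>\<close> between
  \<open>\<beta>\<close> and the maximal mean this is below \<open>\<gamma> * n\<close> when
  \<open>n\<close> is large, a contradiction. A vertex has the weight of its prefix of length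
  \<open>q\<close>.\<close>

lemma cycle_of_large_mean:
  assumes fin: "finite (factors x M)" and M: "q \<le> M" "0 < M" and \<beta>: "\<beta> < max_mean f q x"
  shows "\<exists>c l. 0 < l \<and> l \<le> card (factors x M) \<and> (\<forall>i. c (i + int l) = c i) \<and> factors c M \<subseteq> factors x M \<and>
    \<beta> * real l \<le> window_sum f q c 0 l"
proof -
  define g where "g v = f (take q v)" for v
  define R where "R = (\<lambda>u v :: 'a list. tl u = butlast v)"
  have "\<exists>vs. vs \<noteq> [] \<and> set vs \<subseteq> factors x M \<and> distinct vs \<and> successively R vs \<and>
      R (last vs) (hd vs) \<and> \<beta> * real (length vs) \<le> sum_list (map g vs)"
  proof (rule ccontr)
    assume no: "\<not> ?thesis"
    define \<gamma> where "\<gamma> = (\<beta> + max_mean f q x) / 2"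
    have \<gamma>: "\<beta> < \<gamma>" "\<gamma> < max_mean f q x" using \<beta> by (simp_all add: \<gamma>_def)
    define C where "C = (1 + \<bar>\<beta>\<bar>) * real (card (factors x M))"
    define n where "n = nat \<lceil>C / (\<gamma> - \<beta>)\<rceil> + 1"
    have "C / (\<gamma> - \<beta>) < real n" unfolding n_def by linarith
    then have Cn: "C < (\<gamma> - \<beta>) * real n" using \<gamma> by (simp add: field_simps)
    obtain i where i: "\<gamma> * real n \<le> window_sum f q x i n"
      using max_mean_lower[OF \<gamma>(2)] by blast
    define ws where "ws = map (\<lambda>t. word_at x (i + int t) M) [0..<n]"
    have "sum_list (map g ws) \<le> \<beta> * real (length ws) + (1 + \<bar>\<beta>\<bar>) * real (card (factors x M))"
    proof (rule simple_cycle_bound[OF fin, where R = R])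
      show "g v \<le> 1" for v by (simp add: g_def f)
      show "set ws \<subseteq> factors x M" by (auto simp: ws_def)
      show "successively R ws"
        unfolding successively_conv_nth R_def
      proof (intro allI impI)
        fix t assume "Suc t < length ws"
        obtain M' where M': "M = Suc M'" using M(2) by (cases M) auto
        have "tl (word_at x (i + int t) M) = butlast (word_at x (i + int t + 1) M)"
          unfolding M' by (simp add: tl_word_at butlast_word_at)
        then show "tl (ws ! t) = butlast (ws ! Suc t)"
          using \<open>Suc t < length ws\<close> by (simp add: ws_def algebra_simps)
      qed
      show "sum_list (map g vs) \<le> \<beta> * real (length vs)"
        if "vs \<noteq> []" "set vs \<subseteq> factors x M" "distinct vs" "successively R vs" "R (last vs) (hd vs)" for vs
        using no that by (meson linear)
    qed
    moreover have "sum_list (map g ws) = window_sum f q x i n"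
    proof -
      have "take q (word_at x j M) = word_at x j q" for j
        using M by (intro nth_equalityI) auto
      then show ?thesis
        by (simp add: ws_def g_def window_sum_def comp_def interv_sum_list_conv_sum_set_nat atLeast0LessThan)
    qed
    ultimately have "\<gamma> * real n \<le> \<beta> * real n + C" using i by (simp add: ws_def C_def)
    then show False using Cn by (simp add: algebra_simps)
  qed
  then obtain vs where vs: "vs \<noteq> []" "set vs \<subseteq> factors x M" "distinct vs" "successively R vs"
      "R (last vs) (hd vs)" "\<beta> * real (length vs) \<le> sum_list (map g vs)" by blast
  have len: "length v = M" if "v \<in> set vs" for v using that vs(2) by (auto simp: factors_def)
  obtain c where c: "\<forall>i. c (i + int (length vs)) = c i" "factors c M = set vs"
      "\<And>t. t < length vs \<Longrightarrow> word_at c (int t) M = vs ! t"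
    using sequence_of_cycle[OF vs(1) len M(2)] vs(4,5) unfolding R_def by blast
  have "window_sum f q c 0 (length vs) = sum_list (map g vs)"
  proof -
    have "word_at c (int t) q = take q (vs ! t)" if "t < length vs" for t
    proof -
      have "word_at c (int t) q = take q (word_at c (int t) M)"
        using M by (intro nth_equalityI) auto
      then show ?thesis using c(3)[OF that] by simp
    qed
    then show ?thesis
      by (simp add: window_sum_def g_def sum_list_sum_nth atLeast0LessThan)
  qed
  moreover have "length vs \<le> card (factors x M)"
    using card_mono[OF fin vs(2)] distinct_card[OF vs(3)] by simp
  ultimately show ?thesis using vs c by (intro exI[of _ c] exI[of _ "length vs"]) auto
qed

text \<open>A closed walk of nearly maximal average has no long stretch of low average, as no other
  stretch can make up for it. The linear complexity bounds its period by \<open>6 * m\<close>, so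
  stretches of length proportional to \<open>m\<close> are long enough.\<close>

lemma extremal_cycles:
  assumes fin: "\<And>n. finite (factors x n)" and grow: "\<And>m. m0 \<le> m \<Longrightarrow> card (factors x m) \<le> 3 * m"
    and \<epsilon>: "0 < \<epsilon>" and \<eta>: "0 < \<eta>"
  shows "\<exists>n0. \<forall>m\<ge>n0. \<exists>c. factors c (Suc m) \<subseteq> factors x (Suc m) \<and>
    (\<forall>i n. \<eta> * real m \<le> real n \<longrightarrow> (max_mean f q x - \<epsilon>) * real n \<le> window_sum f q c i n)"
proof -
  define b where "b = max_mean f q x"
  \<comment> \<open>Chosen to make \<open>\<delta> + 24 * \<delta> / \<eta>\<close> equal to
    \<open>\<epsilon> / 2\<close>: the error \<open>4 * \<delta> * l\<close> is at most
    \<open>24 * \<delta> * m\<close>, and \<open>m \<le> n / \<eta>\<close>. The other half of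
    \<open>\<epsilon>\<close> absorbs \<open>2 * N\<close>.\<close>
  define \<delta> where "\<delta> = \<epsilon> / (2 * (1 + 24 / \<eta>))"
  have \<delta>: "0 < \<delta>" using \<epsilon> \<eta> by (simp add: \<delta>_def add_pos_pos)
  have \<delta>\<epsilon>: "\<delta> + 24 * \<delta> / \<eta> = \<epsilon> / 2"
  proof -
    have "1 + 24 / \<eta> > 0" using \<eta> by (simp add: add_pos_pos)
    then have "\<delta> * (1 + 24 / \<eta>) = \<epsilon> / 2" unfolding \<delta>_def by (simp add: field_simps)
    then show ?thesis by (simp add: algebra_simps)
  qed
  obtain N where N: "0 < N" "\<And>i. window_sum f q x i N \<le> (b + \<delta>) * real N"
    using max_mean_upper[of "b + \<delta>"] \<delta> unfolding b_def by auto
  define n0 where "n0 = max (max m0 (N + q)) (nat \<lceil>4 * real N / (\<eta> * \<epsilon>)\<rceil> + 1)"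
  show ?thesis
  proof (intro exI[of _ n0] allI impI)
    fix m assume "n0 \<le> m"
    then have m: "m0 \<le> m" "N + q \<le> m" "nat \<lceil>4 * real N / (\<eta> * \<epsilon>)\<rceil> + 1 \<le> m"
      by (auto simp: n0_def)
    have "4 * real N / (\<eta> * \<epsilon>) < real m" using m(3) by linarith
    then have Nm: "4 * real N < \<epsilon> * (\<eta> * real m)" using \<epsilon> \<eta> by (simp add: field_simps)
    obtain c l where c: "0 < l" "l \<le> card (factors x (Suc m))" "\<And>i. c (i + int l) = c i"
        "factors c (Suc m) \<subseteq> factors x (Suc m)" "(b - \<delta>) * real l \<le> window_sum f q c 0 l"
      using cycle_of_large_mean[OF fin, of "Suc m" "b - \<delta>"] m \<delta> unfolding b_def by auto
    have "card (factors x (Suc m)) \<le> 3 * Suc m" by (rule grow) (use m in simp)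
    then have "l \<le> 6 * m" using c(2) m(2) N(1) by simp
    have cN: "window_sum f q c i N \<le> (b + \<delta>) * real N" for i
    proof -
      have "factors c (N + q) \<subseteq> factors x (N + q)"
        by (rule factors_subset_mono[OF c(4)]) (use m in simp)
      then obtain j where "word_at c i (N + q) = word_at x j (N + q)" unfolding factors_def by blast
      then show ?thesis using N(2)[of j] window_sum_cong by metis
    qed
    show "\<exists>c. factors c (Suc m) \<subseteq> factors x (Suc m) \<and>
      (\<forall>i n. \<eta> * real m \<le> real n \<longrightarrow> (max_mean f q x - \<epsilon>) * real n \<le> window_sum f q c i n)"
    proof (intro exI[of _ c] conjI allI impI c(4))
      fix i n assume n: "\<eta> * real m \<le> real n"
      have "b * real n - \<delta> * real n - 4 * \<delta> * real l - 2 * real N \<le> window_sum f q c i n"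
        by (rule window_sum_periodic_ge[OF f(2) c(3,1,5) N(1) cN])
          (use max_mean_nonneg \<delta> in \<open>auto simp: b_def\<close>)
      moreover have "4 * \<delta> * real l \<le> 24 * \<delta> / \<eta> * real n"
      proof -
        have "4 * \<delta> * real l \<le> 4 * \<delta> * (6 * real m)"
          using \<open>l \<le> 6 * m\<close> \<delta> by (intro mult_left_mono) auto
        also have "\<dots> = 24 * \<delta> / \<eta> * (\<eta> * real m)" using \<eta> by simp
        also have "\<dots> \<le> 24 * \<delta> / \<eta> * real n" using n \<delta> \<eta> by (intro mult_left_mono) auto
        finally show ?thesis .
      qed
      moreover have "2 * real N \<le> \<epsilon> / 2 * real n"
      proof -
        have "\<epsilon> * (\<eta> * real m) \<le> \<epsilon> * real n" using n \<epsilon> by (intro mult_left_mono) auto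
        then show ?thesis using Nm by simp
      qed
      moreover have "\<delta> * real n + 24 * \<delta> / \<eta> * real n = \<epsilon> / 2 * real n"
        using \<delta>\<epsilon> by (metis distrib_right)
      ultimately show "(max_mean f q x - \<epsilon>) * real n \<le> window_sum f q c i n"
        unfolding b_def[symmetric] by (simp add: algebra_simps)
    qed
  qed
qed

end

text \<open>A low frequency of \<open>f\<close> is a high frequency of \<open>1 - f\<close>, so
  \<open>extremal_cycles\<close> provides both families. On long windows the average of
  \<open>f\<close> is at least \<open>\<beta> - \<epsilon>\<close> along \<open>c m\<close> and at
  most \<open>\<alpha> + \<epsilon>\<close> along \<open>d k\<close>, which rules out a long common
  word.\<close>

lemma separated_families:
  fixes f :: "'a list \<Rightarrow> real" and x :: "int \<Rightarrow> 'a"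
  assumes f: "\<And>w. 0 \<le> f w" "\<And>w. f w \<le> 1"
    and fin: "\<And>n. finite (factors x n)" and grow: "\<And>m. m0 \<le> m \<Longrightarrow> card (factors x m) \<le> 3 * m"
    and low: "\<And>n. \<exists>i. window_sum f q x i n \<le> \<alpha> * real n"
    and high: "\<And>n. \<exists>i. \<beta> * real n \<le> window_sum f q x i n"
    and "\<alpha> < \<beta>" and K: "0 < K"
  obtains c d n0 where
    "\<And>m. n0 \<le> m \<Longrightarrow> factors (c m) (Suc m) \<subseteq> factors x (Suc m)"
    "\<And>m. n0 \<le> m \<Longrightarrow> factors (d m) (Suc m) \<subseteq> factors x (Suc m)"
    "\<And>m k l. n0 \<le> m \<Longrightarrow> n0 \<le> k \<Longrightarrow> m \<le> K * l \<Longrightarrow> k \<le> K * l \<Longrightarrow> factors (c m) l \<inter> factors (d k) l = {}"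
proof -
  define g where "g w = 1 - f w" for w
  have g: "\<And>w. 0 \<le> g w" "\<And>w. g w \<le> 1" using f by (simp_all add: g_def)
  define \<epsilon> where "\<epsilon> = (\<beta> - \<alpha>) / 3"
  have \<epsilon>: "0 < \<epsilon>" using \<open>\<alpha> < \<beta>\<close> by (simp add: \<epsilon>_def)
  \<comment> \<open>A common word of length \<open>l\<close> gives a window of length
    \<open>l - q \<ge> l / 2\<close>, which is at least \<open>m / (2 * K)\<close> if
    \<open>m \<le> K * l\<close>.\<close>
  define \<eta> where "\<eta> = 1 / (2 * real K)"
  have \<eta>: "0 < \<eta>" using K by (simp add: \<eta>_def)
  have bf: "\<beta> \<le> max_mean f q x" by (rule le_max_mean[where f = f, OF f high])
  have bg: "1 - \<alpha> \<le> max_mean g q x"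
  proof (rule le_max_mean[where f = g, OF g])
    fix n
    obtain i where "window_sum f q x i n \<le> \<alpha> * real n" using low by blast
    then have "(1 - \<alpha>) * real n \<le> window_sum g q x i n"
      unfolding g_def window_sum_complement by (simp add: algebra_simps)
    then show "\<exists>i. (1 - \<alpha>) * real n \<le> window_sum g q x i n" by blast
  qed
  obtain n1 where n1: "\<forall>m\<ge>n1. \<exists>c. factors c (Suc m) \<subseteq> factors x (Suc m) \<and>
    (\<forall>i n. \<eta> * real m \<le> real n \<longrightarrow> (max_mean f q x - \<epsilon>) * real n \<le> window_sum f q c i n)"
    using extremal_cycles[where f = f and q = q, OF f fin grow \<epsilon> \<eta>] by blast
  obtain n2 where n2: "\<forall>m\<ge>n2. \<exists>c. factors c (Suc m) \<subseteq> factors x (Suc m) \<and>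
    (\<forall>i n. \<eta> * real m \<le> real n \<longrightarrow> (max_mean g q x - \<epsilon>) * real n \<le> window_sum g q c i n)"
    using extremal_cycles[where f = g and q = q, OF g fin grow \<epsilon> \<eta>] by blast
  obtain c where c: "\<And>m. n1 \<le> m \<Longrightarrow> factors (c m) (Suc m) \<subseteq> factors x (Suc m)"
    "\<And>m i n. n1 \<le> m \<Longrightarrow> \<eta> * real m \<le> real n \<Longrightarrow> (max_mean f q x - \<epsilon>) * real n \<le> window_sum f q (c m) i n"
  proof -
    have "\<forall>m. \<exists>c. n1 \<le> m \<longrightarrow> factors c (Suc m) \<subseteq> factors x (Suc m) \<and>
      (\<forall>i n. \<eta> * real m \<le> real n \<longrightarrow> (max_mean f q x - \<epsilon>) * real n \<le> window_sum f q c i n)"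
      using n1 by blast
    from choice[OF this] show thesis using that by blast
  qed
  obtain d where d: "\<And>m. n2 \<le> m \<Longrightarrow> factors (d m) (Suc m) \<subseteq> factors x (Suc m)"
    "\<And>m i n. n2 \<le> m \<Longrightarrow> \<eta> * real m \<le> real n \<Longrightarrow> (max_mean g q x - \<epsilon>) * real n \<le> window_sum g q (d m) i n"
  proof -
    have "\<forall>m. \<exists>c. n2 \<le> m \<longrightarrow> factors c (Suc m) \<subseteq> factors x (Suc m) \<and>
      (\<forall>i n. \<eta> * real m \<le> real n \<longrightarrow> (max_mean g q x - \<epsilon>) * real n \<le> window_sum g q c i n)"
      using n2 by blast
    from choice[OF this] show thesis using that by blast
  qed
  define n0 where "n0 = max (max n1 n2) (K * (2 * q + 1))"
  show thesis
  proof (rule that[of n0 c d])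
    show "factors (c m) (Suc m) \<subseteq> factors x (Suc m)" "factors (d m) (Suc m) \<subseteq> factors x (Suc m)"
      if "n0 \<le> m" for m using that c(1) d(1) by (simp_all add: n0_def)
    fix m k l assume mkl: "n0 \<le> m" "n0 \<le> k" "m \<le> K * l" "k \<le> K * l"
    have "K * (2 * q + 1) \<le> K * l" using mkl by (simp add: n0_def)
    then have lq: "2 * q + 1 \<le> l" using K mult_le_cancel1 by blast
    define n where "n = l - q"
    have n: "0 < n" "l \<le> 2 * n" "n + q = l" using lq by (auto simp: n_def)
    have large: "\<eta> * real j \<le> real n" if "j \<le> K * l" for j
    proof -
      have "j \<le> K * (2 * n)" using that n(2) by (meson le_trans mult_le_mono2)
      then have "real j \<le> real (K * (2 * n))" by (rule of_nat_mono)
      then show ?thesis using K by (simp add: \<eta>_def field_simps)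
    qed
    show "factors (c m) l \<inter> factors (d k) l = {}"
    proof (rule ccontr)
      assume "\<not> ?thesis"
      then obtain i j where ij: "word_at (c m) i (n + q) = word_at (d k) j (n + q)"
        unfolding n(3) by (auto simp: factors_def)
      have "(max_mean f q x - \<epsilon>) * real n \<le> window_sum f q (c m) i n"
        by (rule c(2)[OF _ large]) (use mkl in \<open>auto simp: n0_def\<close>)
      moreover have "(max_mean g q x - \<epsilon>) * real n \<le> window_sum g q (d k) j n"
        by (rule d(2)[OF _ large]) (use mkl in \<open>auto simp: n0_def\<close>)
      moreover have "window_sum g q (d k) j n = real n - window_sum f q (c m) i n"
        unfolding g_def window_sum_complement using window_sum_cong[OF ij] by metis
      ultimately have "(max_mean f q x + max_mean g q x - 2 * \<epsilon> - 1) * real n \<le> 0"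
        by (simp add: algebra_simps)
      moreover have "0 < max_mean f q x + max_mean g q x - 2 * \<epsilon> - 1"
        using bf bg \<open>\<alpha> < \<beta>\<close> by (simp add: \<epsilon>_def field_simps)
      ultimately show False using n(1) by (simp add: mult_le_0_iff)
    qed
  qed
qed

section \<open>Invariant measures\<close>

definition cylinder :: "(int \<Rightarrow> 'a) set \<Rightarrow> int \<Rightarrow> nat \<Rightarrow> 'a list set \<Rightarrow> (int \<Rightarrow> 'a) set" where
  "cylinder X k n W = {y \<in> X. word_at y k n \<in> W}"

definition central_cylinders :: "(int \<Rightarrow> 'a) set \<Rightarrow> (int \<Rightarrow> 'a) set set" where
  "central_cylinders X = {cylinder X (- int n) (2 * n + 1) {w} | n w. True}"

lemma central_word_eq_iff:
  "word_at y (- int n) (2 * n + 1) = word_at z (- int n) (2 * n + 1) \<longleftrightarrow> (\<forall>j. \<bar>j\<bar> \<le> int n \<longrightarrow> y j = z j)"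
  unfolding word_at_eq_iff
proof safe
  fix j assume *: "\<forall>i<2 * n + 1. y (- int n + int i) = z (- int n + int i)" and j: "\<bar>j\<bar> \<le> int n"
  have "- int n + int (nat (j + int n)) = j" "nat (j + int n) < 2 * n + 1" using j by linarith+
  then show "y j = z j" using * by metis
qed auto

text \<open>Of two words centred at \<open>0\<close> the longer one determines the shorter one, so
  central cylinders are nested or disjoint.\<close>

lemma Int_stable_central_cylinders: "Int_stable (insert X (central_cylinders X))"
proof -
  have *: "cylinder X (- int n) (2 * n + 1) {v} \<inter> cylinder X (- int m) (2 * m + 1) {w} \<in> central_cylinders X"
    if "n \<le> m" for n m :: nat and v w :: "'a list"
  proof (cases "cylinder X (- int n) (2 * n + 1) {v} \<inter> cylinder X (- int m) (2 * m + 1) {w} = {}")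
    case True
    \<comment> \<open>The empty set is a central cylinder as well, since \<open>[]\<close> has the
      wrong length.\<close>
    moreover have "cylinder X (- int 0) (2 * 0 + 1) {[]} = {}"
      by (auto simp: cylinder_def word_at_def)
    ultimately show ?thesis unfolding central_cylinders_def by blast
  next
    case False
    then obtain z where z: "word_at z (- int n) (2 * n + 1) = v" "word_at z (- int m) (2 * m + 1) = w"
      by (auto simp: cylinder_def)
    have "cylinder X (- int n) (2 * n + 1) {v} \<inter> cylinder X (- int m) (2 * m + 1) {w} =
        cylinder X (- int m) (2 * m + 1) {w}"
      unfolding cylinder_def singleton_iff z[symmetric] central_word_eq_iff using that by auto
    then show ?thesis unfolding central_cylinders_def by auto
  qed
  have **: "a \<inter> b \<in> central_cylinders X" if "a \<in> central_cylinders X" "b \<in> central_cylinders X" for a b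
  proof -
    obtain n v m w where "a = cylinder X (- int n) (2 * n + 1) {v}" "b = cylinder X (- int m) (2 * m + 1) {w}"
      using \<open>a \<in> central_cylinders X\<close> \<open>b \<in> central_cylinders X\<close> unfolding central_cylinders_def by blast
    then show ?thesis using *[of n m v w] *[of m n w v] by (cases "n \<le> m") (auto simp: Int_commute)
  qed
  have "a \<subseteq> X" if "a \<in> central_cylinders X" for a
    using that by (auto simp: central_cylinders_def cylinder_def)
  then have "a \<inter> X = a" "X \<inter> a = a" if "a \<in> central_cylinders X" for a using that by blast+
  then show ?thesis unfolding Int_stable_def using ** by auto
qed

text \<open>The product of unit intervals is compact, so \<open>h\<close> has a cluster point
  \<open>\<mu>\<close>; \<open>F\<close> refines \<open>sequentially\<close> by the preimages of the
  neighbourhoods of \<open>\<mu>\<close>. A filter is used in place of a subsequence because the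
  index type may be uncountable.\<close>

lemma compact_cluster_filter:
  fixes h :: "nat \<Rightarrow> 'i \<Rightarrow> real"
  assumes "\<And>n i. h n i \<in> {0..1}"
  obtains F \<mu> where "F \<noteq> bot" "F \<le> sequentially" "\<And>i. ((\<lambda>n. h n i) \<longlongrightarrow> \<mu> i) F"
proof -
  let ?S = "Pi\<^sub>E UNIV (\<lambda>_ :: 'i. {0..1 :: real})"
  have "compactin (product_topology (\<lambda>_ :: 'i. euclidean :: real topology) UNIV) ?S"
    by (simp add: compactin_PiE)
  then have "compact ?S" by (simp add: euclidean_product_topology)
  moreover have "filtermap h sequentially \<noteq> bot" by (simp add: filtermap_bot_iff)
  moreover have "eventually (\<lambda>g. g \<in> ?S) (filtermap h sequentially)"
    using assms by (simp add: eventually_filtermap PiE_iff)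
  ultimately obtain \<mu> where \<mu>: "inf (nhds \<mu>) (filtermap h sequentially) \<noteq> bot"
    unfolding compact_filter by blast
  define F where "F = inf sequentially (filtercomap h (nhds \<mu>))"
  show thesis
  proof (rule that)
    show "F \<noteq> bot"
    proof
      assume "F = bot"
      then have "eventually (\<lambda>_. False) F" by simp
      then obtain P Q where PQ: "eventually P sequentially" "eventually Q (nhds \<mu>)" "\<And>n. P n \<Longrightarrow> \<not> Q (h n)"
        unfolding F_def eventually_inf eventually_filtercomap by blast
      have "eventually (\<lambda>g. \<exists>n. P n \<and> g = h n) (filtermap h sequentially)"
        unfolding eventually_filtermap using PQ(1) by (rule eventually_mono) blast
      then have "eventually (\<lambda>_. False) (inf (nhds \<mu>) (filtermap h sequentially))"
        unfolding eventually_inf using PQ by blast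
      then show False using \<mu> by (simp add: trivial_limit_def)
    qed
    show "F \<le> sequentially" by (simp add: F_def)
    fix i
    have lim: "filterlim h (nhds \<mu>) F"
      unfolding F_def by (rule filterlim_mono[OF filterlim_filtercomap order_refl]) simp
    show "((\<lambda>n. h n i) \<longlongrightarrow> \<mu> i) F"
    proof (rule topological_tendstoI)
      fix S :: "real set" assume S: "open S" "\<mu> i \<in> S"
      have "open ((\<lambda>g. g i) -` S :: ('i \<Rightarrow> real) set)"
        by (rule open_vimage[OF S(1) continuous_on_product_coordinates])
      from topological_tendstoD[OF lim this] show "eventually (\<lambda>n. h n i \<in> S) F"
        using S(2) by simp
    qed
  qed
qed

section \<open>Cylinders and Borel sets of a subshift\<close>

locale shift_space =
  fixes A :: "'a set" and X :: "(int \<Rightarrow> 'a) set"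
  assumes finA: "finite A" and sub: "subshift A X"
begin

definition X_top where "X_top = subtopology (full_shift A) X"

lemma closedin_X: "closedin (full_shift A) X"
  using sub by (simp add: subshift_def)

lemma in_A: "y \<in> X \<Longrightarrow> y k \<in> A"
  using closedin_subset[OF closedin_X] by (auto simp: topspace_full_shift)

lemma topspace_X_top [simp]: "topspace X_top = X"
  using closedin_subset[OF closedin_X] by (auto simp: X_top_def)

lemma shift_X: "y \<in> X \<Longrightarrow> shift y \<in> X"
  using sub by (auto simp: subshift_def)

lemma shift_pow_X: "y \<in> X \<Longrightarrow> shift_pow (int n) y \<in> X"
proof (induction n)
  case (Suc n)
  have "shift_pow (int (Suc n)) y = shift (shift_pow (int n) y)"
    by (simp add: shift_pow_def shift_def fun_eq_iff algebra_simps)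
  then show ?case using Suc shift_X by simp
qed (simp add: shift_pow_def)

lemma compact_space_X_top: "compact_space X_top"
proof -
  have "compact_space (full_shift A)"
    using finA by (simp add: full_shift_def compact_space_product_topology compact_space_discrete_topology)
  then show ?thesis unfolding X_top_def using closedin_X closedin_compact_space compact_space_subtopology by blast
qed

lemma openin_cylinder: "openin X_top (cylinder X k n W)"
proof (subst openin_subopen, intro ballI)
  fix y assume y: "y \<in> cylinder X k n W"
  define S where "S j = (if j \<in> {k..<k + int n} then {y j} else A)" for j
  have yA: "y j \<in> A" for j using y in_A by (auto simp: cylinder_def)
  have "finite {j. S j \<noteq> A}"
    by (rule finite_subset[of _ "{k..<k + int n}"]) (auto simp: S_def)
  then have "openin (full_shift A) (Pi\<^sub>E UNIV S)"
    unfolding full_shift_def openin_PiE_gen using yA by (auto simp: S_def)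
  then have "openin X_top (Pi\<^sub>E UNIV S \<inter> X)" unfolding X_top_def openin_subtopology by blast
  moreover have "y \<in> Pi\<^sub>E UNIV S \<inter> X" using y yA by (auto simp: S_def cylinder_def)
  moreover have "Pi\<^sub>E UNIV S \<inter> X \<subseteq> cylinder X k n W"
  proof
    fix z assume z: "z \<in> Pi\<^sub>E UNIV S \<inter> X"
    have "z (k + int i) = y (k + int i)" if "i < n" for i
    proof -
      have "z (k + int i) \<in> S (k + int i)" using z by (auto simp: PiE_iff)
      then show ?thesis using that by (simp add: S_def)
    qed
    then have "word_at z k n = word_at y k n" by (simp add: word_at_eq_iff)
    then show "z \<in> cylinder X k n W" using y z by (simp add: cylinder_def)
  qed
  ultimately show "\<exists>U. openin X_top U \<and> y \<in> U \<and> U \<subseteq> cylinder X k n W" by blast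
qed

lemma closedin_cylinder: "closedin X_top (cylinder X k n W)"
proof -
  have "topspace X_top - cylinder X k n W = cylinder X k n (- W)" "cylinder X k n W \<subseteq> topspace X_top"
    by (auto simp: cylinder_def)
  then show ?thesis unfolding closedin_def using openin_cylinder by metis
qed

lemma central_cylinder_in_open:
  assumes U: "openin X_top U" and y: "y \<in> U"
  obtains n where "cylinder X (- int n) (2 * n + 1) {word_at y (- int n) (2 * n + 1)} \<subseteq> U"
proof -
  obtain V where V: "openin (full_shift A) V" "U = V \<inter> X" using U by (auto simp: X_top_def openin_subtopology)
  obtain S where S: "finite {j. S j \<noteq> A}" "y \<in> Pi\<^sub>E UNIV S" "Pi\<^sub>E UNIV S \<subseteq> V"
    using V y unfolding full_shift_def openin_product_topology_alt by force
  define n where "n = nat (Max (insert 0 (abs ` {j. S j \<noteq> A})))"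
  have n: "\<bar>j\<bar> \<le> int n" if "S j \<noteq> A" for j
  proof -
    have "\<bar>j\<bar> \<le> Max (insert 0 (abs ` {j. S j \<noteq> A}))"
      using S(1) that by (intro Max_ge) auto
    moreover have "0 \<le> Max (insert 0 (abs ` {j. S j \<noteq> A}))"
      using S(1) by (intro Max_ge) auto
    ultimately show ?thesis unfolding n_def by linarith
  qed
  have "cylinder X (- int n) (2 * n + 1) {word_at y (- int n) (2 * n + 1)} \<subseteq> U"
  proof
    fix z assume "z \<in> cylinder X (- int n) (2 * n + 1) {word_at y (- int n) (2 * n + 1)}"
    then have zX: "z \<in> X" and "word_at z (- int n) (2 * n + 1) = word_at y (- int n) (2 * n + 1)"
      unfolding cylinder_def by auto
    then have z: "z j = y j" if "\<bar>j\<bar> \<le> int n" for j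
      unfolding central_word_eq_iff using that by blast
    have "z j \<in> S j" for j
      using z[of j] n[of j] S(2) in_A[OF zX, of j] by (cases "S j = A") (auto simp: PiE_iff)
    then show "z \<in> U" using S(3) V zX by (auto simp: PiE_iff)
  qed
  then show thesis by (rule that)
qed

text \<open>Over a finite alphabet there are only countably many words, so every open set is a
  countable union of central cylinders.\<close>

lemma sets_borel: "sets (borel_algebra X_top) = sigma_sets X (insert X (central_cylinders X))"
proof
  have "{U. openin X_top U} \<subseteq> sigma_sets X (insert X (central_cylinders X))"
  proof
    fix U assume "U \<in> {U. openin X_top U}"
    then have U: "openin X_top U" by simp
    then have UX: "U \<subseteq> X" using openin_subset by fastforce
    define I where "I = {(n, w). w \<in> lists A \<and> cylinder X (- int n) (2 * n + 1) {w} \<subseteq> U}"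
    define \<C> where "\<C> = (\<lambda>(n, w). cylinder X (- int n) (2 * n + 1) {w}) ` I"
    have "I \<subseteq> UNIV \<times> lists A" by (auto simp: I_def)
    moreover have "countable (UNIV \<times> lists A :: (nat \<times> 'a list) set)"
      using finA by (simp add: countable_lists countable_finite)
    ultimately have "countable \<C>" unfolding \<C>_def by (meson countable_image countable_subset)
    moreover have "b \<in> sigma_sets X (insert X (central_cylinders X))" if "b \<in> \<C>" for b
      using that unfolding \<C>_def I_def central_cylinders_def by (intro sigma_sets.Basic) auto
    ultimately have "\<Union>\<C> \<in> sigma_sets X (insert X (central_cylinders X))"
      by (rule sigma_sets_UNION)
    moreover have "\<Union>\<C> = U"
    proof
      show "\<Union>\<C> \<subseteq> U" by (auto simp: \<C>_def I_def)
      show "U \<subseteq> \<Union>\<C>"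
      proof
        fix y assume y: "y \<in> U"
        obtain n where n: "cylinder X (- int n) (2 * n + 1) {word_at y (- int n) (2 * n + 1)} \<subseteq> U"
          by (rule central_cylinder_in_open[OF U y])
        have "y \<in> X" using y UX by blast
        then have "word_at y (- int n) (2 * n + 1) \<in> lists A"
          using in_A by (auto simp: word_at_def)
        then have "(n, word_at y (- int n) (2 * n + 1)) \<in> I" using n by (simp add: I_def)
        moreover have "y \<in> cylinder X (- int n) (2 * n + 1) {word_at y (- int n) (2 * n + 1)}"
          using y UX by (auto simp: cylinder_def)
        ultimately show "y \<in> \<Union>\<C>" unfolding \<C>_def by blast
      qed
    qed
    ultimately show "U \<in> sigma_sets X (insert X (central_cylinders X))" by simp
  qed
  then show "sets (borel_algebra X_top) \<subseteq> sigma_sets X (insert X (central_cylinders X))"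
    unfolding sets_borel_algebra topspace_X_top by (rule sigma_sets_mono)
  have "insert X (central_cylinders X) \<subseteq> sigma_sets X {U. openin X_top U}"
    using openin_cylinder openin_topspace[of X_top] by (auto simp: central_cylinders_def)
  then show "sigma_sets X (insert X (central_cylinders X)) \<subseteq> sets (borel_algebra X_top)"
    unfolding sets_borel_algebra topspace_X_top by (rule sigma_sets_mono)
qed

lemma cylinder_measurable: "cylinder X k n W \<in> sets (borel_algebra X_top)"
  using openin_cylinder by (auto simp: sets_borel_algebra)

lemma measure_eqI_cylinders:
  assumes sets: "sets M = sets (borel_algebra X_top)" "sets N = sets (borel_algebra X_top)"
    and prob: "prob_space M" "prob_space N"
    and eq: "\<And>k n w. emeasure M (cylinder X k n {w}) = emeasure N (cylinder X k n {w})"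
  shows "M = N"
proof -
  have space: "space M = X" "space N = X"
    using sets sets_eq_imp_space_eq[of _ "borel_algebra X_top"] by (auto simp: space_borel_algebra)
  show ?thesis
  proof (rule measure_eqI_generator_eq[OF Int_stable_central_cylinders[of X], where \<Omega> = X and A = "\<lambda>_. X"])
    show "insert X (central_cylinders X) \<subseteq> Pow X"
      by (auto simp: central_cylinders_def cylinder_def)
    show "emeasure M B = emeasure N B" if "B \<in> insert X (central_cylinders X)" for B
      using that eq prob_space.emeasure_space_1[OF prob(1)] prob_space.emeasure_space_1[OF prob(2)] space
      by (auto simp: central_cylinders_def)
    show "emeasure M X \<noteq> \<infinity>" for i :: nat
      using prob_space.emeasure_space_1[OF prob(1)] space by simp
  qed (use sets sets_borel in auto)
qed

lemma shift_vimage_cylinder: "shift -` cylinder X k n W \<inter> X = cylinder X (k + 1) n W"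
proof -
  have "word_at (shift y) k n = word_at y (k + 1) n" for y :: "int \<Rightarrow> 'a"
    by (simp add: word_at_def shift_def algebra_simps)
  then show ?thesis using shift_X by (auto simp: cylinder_def)
qed

section \<open>Existence of invariant measures and word frequencies\<close>

lemma invariant_cylinder:
  assumes "invariant_prob A X M"
  shows "emeasure M (cylinder X k n W) = emeasure M (cylinder X 0 n W)"
proof -
  have step: "emeasure M (cylinder X (k + 1) n W) = emeasure M (cylinder X k n W)" for k
    using assms cylinder_measurable[unfolded X_top_def] unfolding invariant_prob_def
    by (metis shift_vimage_cylinder)
  show ?thesis
  proof (induction k rule: int_induct[where k = 0])
    case (step2 i)
    then show ?case using step[of "i - 1"] by simp
  qed (use step in auto)
qed

text \<open>The Krylov-Bogolyubov argument. Averages along the forward orbit converge along a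
  filter, for all sets at once, to a finitely additive invariant \<open>\<mu>\<close>. Its
  restriction to the clopen sets extends to a measure.\<close>

theorem ex_invariant_prob:
  assumes x: "x \<in> X"
  shows "\<exists>M. invariant_prob A X M"
proof -
  define orb where "orb t = shift_pow (int t) x" for t
  have orb: "orb t \<in> X" for t using shift_pow_X[OF x] by (simp add: orb_def)
  have orb_Suc: "shift (orb t) = orb (Suc t)" for t
    by (simp add: orb_def shift_def shift_pow_def fun_eq_iff algebra_simps)
  define h where "h n B = (\<Sum>t<n. indicator B (orb t)) / real n" for n and B :: "(int \<Rightarrow> 'a) set"
  have h01: "h n B \<in> {0..1}" for n B
  proof -
    have "(\<Sum>t<n. indicator B (orb t) :: real) \<le> (\<Sum>t<n. 1)"
      by (intro sum_mono) (simp add: indicator_le_1)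
    then show ?thesis
      unfolding h_def by (cases "n = 0") (auto simp: field_simps intro!: sum_nonneg divide_nonneg_nonneg)
  qed
  obtain F \<mu> where F: "F \<noteq> bot" "F \<le> sequentially" "\<And>B. ((\<lambda>n. h n B) \<longlongrightarrow> \<mu> B) F"
    using compact_cluster_filter[of h, OF h01] by blast
  have \<mu>_eq: "c = \<mu> B" if "(\<lambda>n. h n B) \<longlonglongrightarrow> c" for B c
    using tendsto_unique[OF F(1) filterlim_mono[OF that order_refl F(2)] F(3)] .
  have \<mu>0: "0 \<le> \<mu> B" for B
    by (rule tendsto_lowerbound[OF F(3) _ F(1)]) (use h01 in auto)
  have \<mu>1: "\<mu> X = 1"
  proof (rule \<mu>_eq[symmetric])
    have "eventually (\<lambda>n. 1 = h n X) sequentially"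
      using eventually_gt_at_top[of 0] by eventually_elim (use orb in \<open>simp add: h_def\<close>)
    then show "(\<lambda>n. h n X) \<longlonglongrightarrow> 1" by (rule tendsto_eventually[OF eventually_mono]) simp
  qed
  have \<mu>_empty: "\<mu> {} = 0"
    by (rule \<mu>_eq[symmetric]) (simp add: h_def)
  have \<mu>_add: "\<mu> (B \<union> C) = \<mu> B + \<mu> C" if "B \<inter> C = {}" for B C
  proof -
    have "indicator (B \<union> C) u = (indicator B u + indicator C u :: real)" for u
      using that by (auto simp: indicator_def)
    then have "h n (B \<union> C) = h n B + h n C" for n
      by (simp add: h_def sum.distrib add_divide_distrib)
    then have "((\<lambda>n. h n (B \<union> C)) \<longlongrightarrow> \<mu> B + \<mu> C) F"
      using tendsto_add[OF F(3)[of B] F(3)[of C]] by simp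
    then show ?thesis using tendsto_unique[OF F(1) F(3)] by blast
  qed
  have \<mu>_shift: "\<mu> (shift -` B \<inter> X) = \<mu> B" for B
  proof -
    have diff: "h n (shift -` B \<inter> X) - h n B = (indicator B (orb n) - indicator B (orb 0)) / real n" for n
    proof -
      have "indicator (shift -` B \<inter> X) (orb t) = (indicator B (orb (Suc t)) :: real)" for t
        using orb orb_Suc by (simp add: indicator_def)
      then have "h n (shift -` B \<inter> X) - h n B =
          (\<Sum>t<n. indicator B (orb (Suc t)) - indicator B (orb t)) / real n"
        by (simp add: h_def sum_subtractf diff_divide_distrib)
      then show ?thesis using sum_lessThan_telescope[of "\<lambda>t. indicator B (orb t) :: real" n] by simp
    qed
    have "(\<lambda>n. h n (shift -` B \<inter> X) - h n B) \<longlonglongrightarrow> 0"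
    proof (rule Lim_null_comparison)
      show "eventually (\<lambda>n. norm (h n (shift -` B \<inter> X) - h n B) \<le> 1 / real n) sequentially"
        unfolding diff by (intro always_eventually allI) (auto simp: indicator_def)
      show "(\<lambda>n. 1 / real n) \<longlonglongrightarrow> 0" by (rule lim_1_over_n)
    qed
    then have "((\<lambda>n. h n (shift -` B \<inter> X) - h n B) \<longlongrightarrow> 0) F"
      by (rule filterlim_mono[OF _ order_refl F(2)])
    then have "\<mu> (shift -` B \<inter> X) - \<mu> B = 0"
      using tendsto_unique[OF F(1) tendsto_diff[OF F(3) F(3)]] by blast
    then show ?thesis by simp
  qed
  \<comment> \<open>By compactness a decreasing sequence of clopen sets with empty intersection is
    eventually empty, so \<open>\<mu>\<close> is a premeasure on \<open>\<G>\<close>.\<close>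
  define \<G> where "\<G> = {U. openin X_top U \<and> closedin X_top U}"
  have GX: "\<G> \<subseteq> Pow X" using openin_subset[of X_top] by (auto simp: \<G>_def)
  have XG: "X \<in> \<G>" using openin_topspace[of X_top] closedin_topspace[of X_top] by (simp add: \<G>_def)
  interpret ring_of_sets X \<G>
    unfolding ring_of_sets_iff using GX by (auto simp: \<G>_def openin_diff closedin_diff)
  have "\<exists>\<nu>. (\<forall>B \<in> \<G>. \<nu> B = ennreal (\<mu> B)) \<and> measure_space X (sigma_sets X \<G>) \<nu>"
  proof (rule caratheodory_empty_continuous)
    show "positive \<G> (\<lambda>B. ennreal (\<mu> B))" by (simp add: positive_def \<mu>_empty)
    show "additive \<G> (\<lambda>B. ennreal (\<mu> B))"
      unfolding additive_def using \<mu>_add \<mu>0 by (simp add: ennreal_plus)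
    show "(\<lambda>i. ennreal (\<mu> (B i))) \<longlonglongrightarrow> 0"
      if B: "range B \<subseteq> \<G>" "decseq B" "(\<Inter>i. B i) = {}" for B
    proof -
      have "\<exists>i. B i = {}"
        using compact_space_imp_nest[OF compact_space_X_top, of B] B by (auto simp: \<G>_def)
      then obtain i where i: "B i = {}" by blast
      have "B j = {}" if "i \<le> j" for j using decseqD[OF B(2) that] i by simp
      then have "eventually (\<lambda>j. ennreal (\<mu> (B j)) = 0) sequentially"
        unfolding eventually_sequentially by (auto intro!: exI[of _ i] simp: \<mu>_empty)
      then show ?thesis by (rule tendsto_eventually)
    qed
  qed simp
  then obtain \<nu> where \<nu>: "\<And>B. B \<in> \<G> \<Longrightarrow> \<nu> B = ennreal (\<mu> B)" "measure_space X (sigma_sets X \<G>) \<nu>" by blast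
  define M where "M = measure_of X (sigma_sets X \<G>) \<nu>"
  have sa: "sigma_algebra X (sigma_sets X \<G>)" by (rule sigma_algebra_sigma_sets[OF GX])
  have setsM: "sets M = sigma_sets X \<G>" and spaceM: "space M = X"
    using sa sigma_algebra.sigma_sets_eq[OF sa] sigma_sets_into_sp[OF GX]
    by (auto simp: M_def sets_measure_of_conv space_measure_of_conv)
  have setsM': "sets M = sets (borel_algebra X_top)"
  proof
    show "sets M \<subseteq> sets (borel_algebra X_top)"
      unfolding setsM sets_borel_algebra topspace_X_top by (rule sigma_sets_mono) (auto simp: \<G>_def)
    have "insert X (central_cylinders X) \<subseteq> sigma_sets X \<G>"
      using XG openin_cylinder closedin_cylinder by (auto simp: \<G>_def central_cylinders_def)
    then show "sets (borel_algebra X_top) \<subseteq> sets M"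
      unfolding setsM sets_borel by (rule sigma_sets_mono)
  qed
  have emM: "emeasure M B = ennreal (\<mu> B)" if "B \<in> \<G>" for B
    using \<nu> that unfolding M_def measure_space_def
    by (subst emeasure_measure_of_sigma) auto
  have prob: "prob_space M"
    by (rule prob_spaceI) (simp add: spaceM emM[OF XG] \<mu>1)
  have meas: "shift \<in> measurable M M"
  proof (rule measurable_sigma_sets)
    show "sets M = sigma_sets X (insert X (central_cylinders X))" using setsM' sets_borel by simp
    show "insert X (central_cylinders X) \<subseteq> Pow X" by (auto simp: central_cylinders_def cylinder_def)
    show "shift \<in> space M \<rightarrow> X" using shift_X by (auto simp: spaceM)
    fix B assume "B \<in> insert X (central_cylinders X)"
    then consider "B = X" | n w where "B = cylinder X (- int n) (2 * n + 1) {w}"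
      by (auto simp: central_cylinders_def)
    then show "shift -` B \<inter> space M \<in> sets M"
    proof cases
      case 1
      then have "shift -` B \<inter> space M = space M" using shift_X by (auto simp: spaceM)
      then show ?thesis by simp
    next
      case 2
      then show ?thesis using shift_vimage_cylinder cylinder_measurable by (simp only: spaceM setsM')
    qed
  qed
  have "distr M M shift = M"
  proof (rule measure_eqI_cylinders)
    show "prob_space (distr M M shift)" by (rule prob_space.prob_space_distr[OF prob meas])
    fix k n w
    have G: "cylinder X j n {w} \<in> \<G>" for j using openin_cylinder closedin_cylinder by (simp add: \<G>_def)
    have "emeasure (distr M M shift) (cylinder X k n {w}) = emeasure M (shift -` cylinder X k n {w} \<inter> X)"
      using meas cylinder_measurable by (subst emeasure_distr) (simp_all add: setsM' spaceM)
    also have "\<dots> = ennreal (\<mu> (shift -` cylinder X k n {w} \<inter> X))"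
      unfolding shift_vimage_cylinder by (rule emM[OF G])
    also have "\<dots> = emeasure M (cylinder X k n {w})" unfolding \<mu>_shift by (rule emM[OF G, symmetric])
    finally show "emeasure (distr M M shift) (cylinder X k n {w}) = emeasure M (cylinder X k n {w})" .
  qed (use setsM' prob in auto)
  then have "emeasure M (shift -` B \<inter> X) = emeasure M B" if "B \<in> sets M" for B
    using emeasure_distr[OF meas that] by (simp add: spaceM)
  then show ?thesis
    unfolding invariant_prob_def using prob setsM' by (intro exI[of _ M]) (simp add: X_top_def)
qed

text \<open>By invariance the expected number of occurrences of \<open>w\<close> at the first
  \<open>n\<close> positions is \<open>p * n\<close>, so some point has at least that many and some
  point at most that many. The stretch in question also occurs in \<open>x\<close>.\<close>

lemma cylinder_frequency:
  assumes M: "invariant_prob A X M" and words: "\<And>y. y \<in> X \<Longrightarrow> factors y (n + q) \<subseteq> factors x (n + q)"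
    and p: "p = measure M (cylinder X 0 q {w})"
  shows "\<exists>i. p * real n \<le> window_sum (\<lambda>v. of_bool (v = w)) q x i n"
    and "\<exists>i. window_sum (\<lambda>v. of_bool (v = w)) q x i n \<le> p * real n"
proof -
  interpret prob_space M using M by (simp add: invariant_prob_def)
  let ?f = "\<lambda>v :: 'a list. of_bool (v = w) :: real"
  have sets: "sets M = sets (borel_algebra X_top)" using M by (simp add: invariant_prob_def X_top_def)
  have space: "space M = X"
    using sets sets_eq_imp_space_eq[of M "borel_algebra X_top"] by (simp add: space_borel_algebra)
  have cyl: "cylinder X k q {w} \<in> events" for k using cylinder_measurable by (simp add: sets)
  define Z where "Z y = (\<Sum>t<n. indicator (cylinder X (int t) q {w}) y :: real)" for y
  have int: "integrable M Z"
    unfolding Z_def by (intro Bochner_Integration.integrable_sum) (simp add: cyl emeasure_eq_measure)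
  have cylp: "prob (cylinder X k q {w}) = p" for k
    by (simp only: p measure_def invariant_cylinder[OF M, of k])
  have "expectation Z = (\<Sum>t<n. prob (cylinder X (int t) q {w}))"
    unfolding Z_def using cyl
    by (subst Bochner_Integration.integral_sum) (auto simp: emeasure_eq_measure)
  also have "\<dots> = p * real n"
    by (simp add: cylp)
  finally have E: "expectation Z = p * real n" .
  have Z: "\<exists>i. Z y = window_sum ?f q x i n" if y: "y \<in> X" for y
  proof -
    have "Z y = window_sum ?f q y 0 n"
      unfolding Z_def window_sum_def using y by (intro sum.cong) (auto simp: cylinder_def indicator_def)
    moreover obtain i where "word_at y 0 (n + q) = word_at x i (n + q)"
      using words[OF y] unfolding factors_def by blast
    then have "window_sum ?f q y 0 n = window_sum ?f q x i n" by (rule window_sum_cong)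
    ultimately show ?thesis by metis
  qed
  show "\<exists>i. p * real n \<le> window_sum ?f q x i n"
  proof (rule ccontr)
    assume *: "\<not> ?thesis"
    have "Z y < p * real n" if "y \<in> space M" for y
      using Z[of y] * that space by (metis not_le)
    then have "expectation Z < p * real n" by (intro expectation_less[OF int] AE_I2)
    then show False using E by simp
  qed
  show "\<exists>i. window_sum ?f q x i n \<le> p * real n"
  proof (rule ccontr)
    assume *: "\<not> ?thesis"
    have "p * real n < Z y" if "y \<in> space M" for y
      using Z[of y] * that space by (metis not_le)
    then have "p * real n < expectation Z" by (intro expectation_greater[OF int] AE_I2)
    then show False using E by simp
  qed
qed

lemma invariant_prob_eqI:
  assumes M: "invariant_prob A X M" and N: "invariant_prob A X N"
    and eq: "\<And>q w. measure M (cylinder X 0 q {w}) = measure N (cylinder X 0 q {w})"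
  shows "M = N"
proof (rule measure_eqI_cylinders)
  have prob: "prob_space M" "prob_space N" using M N by (simp_all add: invariant_prob_def)
  then show "prob_space M" "prob_space N" .
  show "sets M = sets (borel_algebra X_top)" "sets N = sets (borel_algebra X_top)"
    using M N by (simp_all add: invariant_prob_def X_top_def)
  fix k n w
  have "emeasure M (cylinder X 0 n {w}) = emeasure N (cylinder X 0 n {w})"
    using prob[THEN prob_space.axioms(1)]
    by (simp only: finite_measure.emeasure_eq_measure eq)
  then show "emeasure M (cylinder X k n {w}) = emeasure N (cylinder X k n {w})"
    by (simp only: invariant_cylinder[OF M, of k] invariant_cylinder[OF N, of k])
qed

end

section \<open>Orbit closures and unique ergodicity\<close>

text \<open>The cylinder of a word of \<open>y\<close> is an open neighbourhood of \<open>y\<close>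
  in the full shift, so the orbit of \<open>x\<close> meets it.\<close>

lemma factors_orbit_closure:
  assumes x: "x \<in> topspace (full_shift A)" and X: "X = full_shift A closure_of orbit x" and sub: "subshift A X"
    and fin: "finite A" and y: "y \<in> X"
  shows "factors y n \<subseteq> factors x n"
proof
  interpret full: shift_space A "topspace (full_shift A)"
  proof
    have "shift ` topspace (full_shift A) = topspace (full_shift A)"
    proof
      show "topspace (full_shift A) \<subseteq> shift ` topspace (full_shift A)"
      proof
        fix z assume "z \<in> topspace (full_shift A)"
        then have "(\<lambda>k. z (k - 1)) \<in> topspace (full_shift A)" by (simp add: topspace_full_shift)
        moreover have "shift (\<lambda>k. z (k - 1)) = z" by (simp add: shift_def)
        ultimately show "z \<in> shift ` topspace (full_shift A)" by force
      qed
    qed (auto simp: topspace_full_shift shift_def)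
    then show "subshift A (topspace (full_shift A))" by (simp add: subshift_def)
  qed (rule fin)
  fix v assume "v \<in> factors y n"
  then obtain k where v: "v = word_at y k n" by (auto simp: factors_def)
  let ?U = "cylinder (topspace (full_shift A)) k n {v}"
  have "openin (full_shift A) ?U"
    using full.openin_cylinder[of k n "{v}"] by (simp add: full.X_top_def)
  moreover have "y \<in> ?U" using y X by (auto simp: cylinder_def v in_closure_of)
  ultimately obtain z where z: "z \<in> orbit x" "z \<in> ?U" using y unfolding X in_closure_of by blast
  then obtain m where "z = shift_pow m x" by (auto simp: orbit_def)
  then have "word_at z k n = word_at x (k + m) n"
    by (simp add: word_at_def shift_pow_def algebra_simps)
  then have "v = word_at x (k + m) n" using z(2) by (simp add: cylinder_def)
  then show "v \<in> factors x n" by simp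
qed

lemma words_eq_factors:
  assumes "\<And>y. y \<in> X \<Longrightarrow> factors y n \<subseteq> factors x n" "x \<in> X"
  shows "words X n = factors x n"
proof -
  have "words X n = (\<Union>y\<in>X. factors y n)" by (auto simp: words_def factors_def)
  then show ?thesis using assms by blast
qed

lemma finite_factors:
  assumes "finite A" "x \<in> topspace (full_shift A)"
  shows "finite (factors x n)"
proof (rule finite_subset)
  show "factors x n \<subseteq> {w. set w \<subseteq> A \<and> length w = n}"
    using assms(2) by (auto simp: factors_def word_at_def topspace_full_shift)
qed (rule finite_lists_length_eq[OF assms(1)])

lemma limsup_less_bound:
  assumes "limsup (\<lambda>n. ereal (real (f n) / real n)) < 3"
  obtains \<epsilon> m0 where "0 < \<epsilon>" "\<And>m. m0 \<le> m \<Longrightarrow> real (f m) \<le> (3 - \<epsilon>) * real m"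
proof -
  obtain r :: real where r: "limsup (\<lambda>n. ereal (real (f n) / real n)) < ereal r" "ereal r < 3"
    using ereal_dense2[OF assms] by blast
  obtain N where N: "\<And>n. N \<le> n \<Longrightarrow> ereal (real (f n) / real n) < ereal r"
    using Limsup_lessD[OF r(1)] unfolding eventually_sequentially by blast
  show thesis
  proof (rule that[of "3 - r" "max N 1"])
    show "0 < 3 - r" using r(2) by (simp add: numeral_eq_ereal)
    fix m assume "max N 1 \<le> m"
    then show "real (f m) \<le> (3 - (3 - r)) * real m"
      using N[of m] by (simp add: field_simps)
  qed
qed

theorem theorem1p4:
  fixes A :: "'a set" and X :: "(int \<Rightarrow> 'a) set" and x :: "int \<Rightarrow> 'a"
  assumes "finite A"
    and "x \<in> topspace (full_shift A)"
    and "subshift A X"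
    and "X = full_shift A closure_of orbit x"
    and "recurrent x"
    and "\<not> periodic x"
    and "limsup (\<lambda>n. ereal (real (complexity X n) / real n)) < 3"
  shows "uniquely_ergodic A X"
proof -
  interpret shift_space A X by unfold_locales (use assms in auto)
  have factors: "factors y n \<subseteq> factors x n" if "y \<in> X" for y n
    by (rule factors_orbit_closure[OF assms(2,4,3,1) that])
  have "shift_pow n x \<in> topspace (full_shift A)" for n
    using assms(2) by (simp add: topspace_full_shift shift_pow_def)
  then have "orbit x \<subseteq> X" unfolding assms(4) by (intro closure_of_subset) (auto simp: orbit_def)
  moreover have "x \<in> orbit x"
    unfolding orbit_def by (rule image_eqI[of _ _ 0]) (simp_all add: shift_pow_def)
  ultimately have x: "x \<in> X" by blast
  have complexity: "complexity X n = card (factors x n)" for n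
    unfolding complexity_def using words_eq_factors[OF factors x] by simp
  have fin: "finite (factors x n)" for n by (rule finite_factors[OF assms(1,2)])
  obtain \<epsilon> m0 where \<epsilon>: "0 < \<epsilon>" "\<And>m. m0 \<le> m \<Longrightarrow> real (complexity X m) \<le> (3 - \<epsilon>) * real m"
    using limsup_less_bound[OF assms(7)] by blast
  note bound = \<epsilon>(2)[unfolded complexity]
  have grow: "card (factors x m) \<le> 3 * m" if "m0 \<le> m" for m
  proof -
    have "(3 - \<epsilon>) * real m \<le> 3 * real m" using \<epsilon>(1) by (intro mult_right_mono) auto
    then have "real (card (factors x m)) \<le> real (3 * m)" using bound[OF that] by simp
    then show ?thesis by (simp only: of_nat_le_iff)
  qed
  \<comment> \<open>This is the separation factor \<open>K\<close> that
    \<open>complexity_contradiction\<close> asks for.\<close>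
  define N0 where "N0 = nat \<lceil>4 / \<epsilon>\<rceil> + 2"
  have "4 / \<epsilon> \<le> real N0" unfolding N0_def by linarith
  then have N0: "2 \<le> N0" "4 \<le> real N0 * \<epsilon>" using \<epsilon>(1) by (simp_all add: N0_def field_simps)
  \<comment> \<open>The two unequal measures of a cylinder serve as \<open>\<alpha>\<close> and
    \<open>\<beta>\<close> in \<open>separated_families\<close>.\<close>
  have not_less: "\<not> measure M (cylinder X 0 q {w}) < measure N (cylinder X 0 q {w})"
    if M: "invariant_prob A X M" and N: "invariant_prob A X N" for M N q w
  proof
    assume less: "measure M (cylinder X 0 q {w}) < measure N (cylinder X 0 q {w})"
    obtain c d n0 where cd:
      "\<And>m. n0 \<le> m \<Longrightarrow> factors (c m) (Suc m) \<subseteq> factors x (Suc m)"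
      "\<And>m. n0 \<le> m \<Longrightarrow> factors (d m) (Suc m) \<subseteq> factors x (Suc m)"
      "\<And>m k l. n0 \<le> m \<Longrightarrow> n0 \<le> k \<Longrightarrow> m \<le> N0 * l \<Longrightarrow> k \<le> N0 * l \<Longrightarrow>
        factors (c m) l \<inter> factors (d k) l = {}"
      by (rule separated_families[where f = "\<lambda>v. of_bool (v = w)" and q = q and K = N0, OF _ _ fin grow
            cylinder_frequency(2)[OF M factors refl] cylinder_frequency(1)[OF N factors refl] less])
        (use N0(1) in auto)
    interpret separated_cycles x c d "max n0 m0" N0
      by unfold_locales (use assms(5) fin cd N0(1) in auto)
    show False
      by (rule complexity_contradiction[OF \<epsilon>(1) N0(2)]) (use bound in auto)
  qed
  have "M = N" if "invariant_prob A X M" "invariant_prob A X N" for M N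
  proof (rule invariant_prob_eqI[OF that])
    show "measure M (cylinder X 0 q {w}) = measure N (cylinder X 0 q {w})" for q w
      using not_less[OF that, of q w] not_less[OF that(2,1), of q w] by linarith
  qed
  then show ?thesis
    unfolding uniquely_ergodic_def using ex_invariant_prob[OF x] by blast
qed

end
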